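(* Let $\alpha>0$ and let $S=\{F_t\}_{t\ge0}$ be a semigroup of parabolic self-mappings of $\Delta$ generated by $f\in\mathcal{G}^\alpha[1]$, i.e., $$\lim_{z\to1,\,z\in\Delta}\frac{f(z)}{(1-z)^{1+\alpha}}=a$$ exists finitely and is different from zero. The following two assertions are equivalent: (i) $\{F_t\}_{t\ge0}$ outer conjugates with a group $\{G_t\}_{t\in\mathbb{R}}$ of parabolic automorphisms of $\Delta$, i.e., there is a conformal self-mapping $\psi:\Delta\to\Delta$ such that $$\psi(F_t(z))=G_t(\psi(z)),\qquad t\ge0,\ z\in\Delta;$$ (ii) $$\sup_{t\ge0}\frac{t(1-|F_t(z)|)}{|1-F_t(z)|}=:M(z)<\infty,\qquad z\in\Delta.$$ Moreover, in this case (a) $\alpha\in(0,1]$; (b) $|\arg(-a)|=\frac{\pi}{2}\alpha$; (c) all the trajectories $\{F_t(z)\}_{t\ge0}$, $z\in\Delta$, converge tangentially to the point $z=1$.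
   Context: $\Delta$ is the open unit disk in $\mathbb{C}$. A one-parameter continuous semigroup on $\Delta$ is a family $\{F_t\}_{t\ge0}$ of holomorphic self-mappings of $\Delta$ with $F_0=\mathrm{id}$, $F_{t+s}=F_t\circ F_s$, $\lim_{t\to0^+}F_t(z)=z$. Its generator is $f(z)=\lim_{t\to0^+}\frac{z-F_t(z)}{t}$. $\mathcal{G}[1]$ is the class of all generators of such semigroups with Denjoy-Wolff point $1$, i.e. $\lim_{t\to\infty}F_t(z)=1$ for all $z\in\Delta$. The semigroup is of parabolic type if the angular limit $\angle\lim_{z\to1}f(z)/(z-1)$ equals $0$ (automatic for $f\in\mathcal G^\alpha[1]$, $\alpha>0$). For $\alpha>0$, $\mathcal{G}^\alpha[1]$ is the class of $f\in\mathcal{G}[1]$ for which the unrestricted limit $\lim_{z\to1,\,z\in\Delta}\frac{f(z)}{(1-z)^{1+\alpha}}$ exists, is finite and nonzero. Powers of $1-z$ and $\arg$ are principal values. A conformal self-mapping of $\Delta$ is a univalent holomorphic map $\Delta\to\Delta$, not necessarily surjective. A group of parabolic automorphisms is a one-parameter continuous group $\{G_t\}_{t\in\mathbb{R}}$ of automorphisms of $\Delta$ such that each $G_t$, $t\ne0$, is parabolic. The trajectory $\{F_t(z)\}_{t\ge0}$ converges to $1$ tangentially if $F_t(z)\to1$ and $\lim_{t\to\infty}\frac{1-|F_t(z)|}{|1-F_t(z)|}=0$. *)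

theory Defs
  imports "HOL-Complex_Analysis.Complex_Analysis"
begin

abbreviation unit_disk :: "complex set" where
  "unit_disk \<equiv> ball 0 1"

text \<open>All mappings are total functions on the complex plane, of which only the values on the
  disk matter; a semigroup \<open>F\<close> is constrained only at parameters \<open>t \<ge> 0\<close>.\<close>

definition continuous_semigroup :: "(real \<Rightarrow> complex \<Rightarrow> complex) \<Rightarrow> bool" where
  "continuous_semigroup F \<longleftrightarrow>
     (\<forall>t\<ge>0. F t holomorphic_on unit_disk \<and> F t ` unit_disk \<subseteq> unit_disk) \<and>
     (\<forall>z\<in>unit_disk. F 0 z = z) \<and>
     (\<forall>t\<ge>0. \<forall>s\<ge>0. \<forall>z\<in>unit_disk. F (t + s) z = F t (F s z)) \<and>
     (\<forall>z\<in>unit_disk. ((\<lambda>t. F t z) \<longlongrightarrow> z) (at_right 0))"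

definition generated_by ::
    "(real \<Rightarrow> complex \<Rightarrow> complex) \<Rightarrow> (complex \<Rightarrow> complex) \<Rightarrow> bool" where
  "generated_by F f \<longleftrightarrow>
     (\<forall>z\<in>unit_disk. ((\<lambda>t. (z - F t z) / of_real t) \<longlongrightarrow> f z) (at_right 0))"

definition denjoy_wolff_at_1 :: "(real \<Rightarrow> complex \<Rightarrow> complex) \<Rightarrow> bool" where
  "denjoy_wolff_at_1 F \<longleftrightarrow> (\<forall>z\<in>unit_disk. ((\<lambda>t. F t z) \<longlongrightarrow> 1) at_top)"

definition generators_at_1 :: "(complex \<Rightarrow> complex) set" where
  "generators_at_1 =
     {f. \<exists>F. continuous_semigroup F \<and> generated_by F f \<and> denjoy_wolff_at_1 F}"

definition generators_at_1_of_order :: "real \<Rightarrow> (complex \<Rightarrow> complex) set" where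
  "generators_at_1_of_order \<alpha> =
     {f \<in> generators_at_1. \<exists>a. a \<noteq> 0 \<and>
        ((\<lambda>z. f z / (1 - z) powr of_real (1 + \<alpha>)) \<longlongrightarrow> a) (at 1 within unit_disk)}"

text \<open>The limit at the boundary point \<open>\<zeta>\<close> is taken in every Stolz region of the disk
  with vertex \<open>\<zeta>\<close>; for \<open>k \<le> 1\<close> the region is empty and the condition is void.\<close>

definition has_angular_limit ::
    "(complex \<Rightarrow> complex) \<Rightarrow> complex \<Rightarrow> complex \<Rightarrow> bool" where
  "has_angular_limit g \<zeta> l \<longleftrightarrow>
     (\<forall>k. (g \<longlongrightarrow> l) (at \<zeta> within {z \<in> unit_disk. cmod (\<zeta> - z) < k * (1 - cmod z)}))"

definition parabolic_semigroup ::
    "(real \<Rightarrow> complex \<Rightarrow> complex) \<Rightarrow> (complex \<Rightarrow> complex) \<Rightarrow> bool" where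
  "parabolic_semigroup F f \<longleftrightarrow>
     continuous_semigroup F \<and> generated_by F f \<and> denjoy_wolff_at_1 F \<and>
     has_angular_limit (\<lambda>z. f z / (z - 1)) 1 0"

definition disk_automorphism :: "(complex \<Rightarrow> complex) \<Rightarrow> bool" where
  "disk_automorphism g \<longleftrightarrow> g holomorphic_on unit_disk \<and> bij_betw g unit_disk unit_disk"

text \<open>The values of \<open>g\<close> outside the open disk are irrelevant, so fixed points on the circle
  are those of the continuous extension \<open>h\<close> to the closed disk, which is unique there.\<close>

definition parabolic_automorphism :: "(complex \<Rightarrow> complex) \<Rightarrow> bool" where
  "parabolic_automorphism g \<longleftrightarrow> disk_automorphism g \<and>
     (\<exists>h. continuous_on (cball 0 1) h \<and> (\<forall>z\<in>unit_disk. h z = g z) \<and>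
        (\<exists>\<zeta>\<in>sphere 0 1. {z \<in> cball 0 1. h z = z} = {\<zeta>}))"

definition parabolic_group :: "(real \<Rightarrow> complex \<Rightarrow> complex) \<Rightarrow> bool" where
  "parabolic_group G \<longleftrightarrow>
     (\<forall>t. disk_automorphism (G t)) \<and>
     (\<forall>z\<in>unit_disk. G 0 z = z) \<and>
     (\<forall>t s. \<forall>z\<in>unit_disk. G (t + s) z = G t (G s z)) \<and>
     (\<forall>z\<in>unit_disk. ((\<lambda>t. G t z) \<longlongrightarrow> z) (at 0)) \<and>
     (\<forall>t. t \<noteq> 0 \<longrightarrow> parabolic_automorphism (G t))"

definition conformal_self_mapping :: "(complex \<Rightarrow> complex) \<Rightarrow> bool" where
  "conformal_self_mapping \<psi> \<longleftrightarrow>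
     \<psi> holomorphic_on unit_disk \<and> inj_on \<psi> unit_disk \<and> \<psi> ` unit_disk \<subseteq> unit_disk"

definition outer_conjugate ::
    "(real \<Rightarrow> complex \<Rightarrow> complex) \<Rightarrow> (real \<Rightarrow> complex \<Rightarrow> complex) \<Rightarrow> bool" where
  "outer_conjugate F G \<longleftrightarrow>
     (\<exists>\<psi>. conformal_self_mapping \<psi> \<and> (\<forall>t\<ge>0. \<forall>z\<in>unit_disk. \<psi> (F t z) = G t (\<psi> z)))"

definition converges_tangentially_to_1 :: "(real \<Rightarrow> complex) \<Rightarrow> bool" where
  "converges_tangentially_to_1 w \<longleftrightarrow>
     (w \<longlongrightarrow> 1) at_top \<and>
     ((\<lambda>t. (1 - cmod (w t)) / cmod (1 - w t)) \<longlongrightarrow> 0) at_top"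

end

theory Submission
  imports Defs
begin

text \<open>The generator \<open>f\<close> is holomorphic without zeros, so there is a function \<open>h\<close> with
  \<open>h' = - 1 / f\<close>, and \<open>h (F t z) = h z + t\<close>. By Wolff's lemma \<open>f / (1 - z)\<^sup>2\<close> has nonpositive real
  part, which makes \<open>h\<close> univalent. The semigroup is outer conjugate to a parabolic group iff
  \<open>h\<close> maps the disk into a half-plane bounded by a horizontal line.

  Integrating \<open>f \<sim> a (1 - z)\<^bsup>1+\<alpha>\<^esup>\<close> gives \<open>h \<sim> c (1 - z)\<^bsup>-\<alpha>\<^esup>\<close> with
  \<open>c = - 1 / (\<alpha> a)\<close>. Hence, up to constants, \<open>t (1 - \<bar>F t z\<bar>) / \<bar>1 - F t z\<bar>\<close> is \<open>(1 - \<bar>w\<bar>\<^sup>2) \<bar>h' w\<bar>\<close>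
  at \<open>w = F t z\<close>, which the Schwarz-Pick lemma compares with the distance of \<open>h z + t\<close> to the
  complement of the image of \<open>h\<close>. In a half-plane this distance is bounded; conversely, if it is
  bounded as \<open>t\<close> tends to infinity, the image omits a horizontal line.

  Finally, if \<open>h\<close> maps into a half-plane, the sector covered by \<open>c (1 - z)\<^bsup>-\<alpha>\<^esup>\<close>, of opening
  \<open>\<alpha> \<pi>\<close>, lies in a half-plane whose boundary contains the direction \<open>1\<close> of the trajectories;
  this forces \<open>\<alpha> \<le> 1\<close> and determines the argument of \<open>a\<close>.\<close>

section \<open>Schwarz--Pick lemma\<close>

text \<open>The semigroup is given only through pointwise one-sided limits at \<open>t = 0\<close>,
  whereas the argument needs continuous trajectories, a holomorphic \<open>f\<close> and the
  equation \<open>h (F t z) = h z + t\<close>. Two sources of uniformity bridge the gap: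
  Schwarz-Pick yields one Lipschitz constant for all self-maps of the disk on a smaller disk, and
  Montel's theorem turns pointwise limits into locally uniform ones. Half-planes enter because the
  members of a parabolic group with \<open>t > 0\<close> share one boundary fixed point \<zeta>, and
  the coordinate \<open>1 / (1 - cnj \<zeta> * z)\<close> turns them into imaginary translations.
  Any conjugating map, read in this coordinate, has to be \<open>\<beta> * h + k\<close> with
  \<beta> imaginary, and its range lies in \<open>Re > 1 / 2\<close>. The asymptotics of
  \<open>h\<close> have to hold for unrestricted approach to \<open>1\<close>, because tangential
  trajectories leave every Stolz region. The argument of \<open>c\<close> is then read off from two
  kinds of approach: rays fill out the sector, while a trajectory, on which \<open>h\<close> moves
  in direction \<open>1\<close>, supplies a limiting angle of \<open>1 - F t z\<close>.\<close>

lemma one_minus_cnj_mult_nonzero: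
  assumes "cmod w < 1" "cmod z \<le> 1"
  shows "1 - cnj w * z \<noteq> 0"
proof
  assume "1 - cnj w * z = 0"
  then have "cmod (cnj w * z) = 1"
    by (metis eq_iff_diff_eq_0 norm_one)
  moreover have "cmod w * cmod z \<le> cmod w * 1"
    using assms by (intro mult_left_mono) auto
  ultimately show False
    using assms by (simp add: norm_mult)
qed

lemma one_minus_cmod_Moebius_function:
  assumes "cmod w < 1" "cmod z < 1"
  shows "1 - (cmod (Moebius_function 0 w z))\<^sup>2
    = (1 - (cmod w)\<^sup>2) * (1 - (cmod z)\<^sup>2) / (cmod (1 - cnj w * z))\<^sup>2"
proof -
  have nz: "1 - cnj w * z \<noteq> 0"
    using assms by (intro one_minus_cnj_mult_nonzero) auto
  have "(cmod (1 - cnj w * z))\<^sup>2 - (cmod (z - w))\<^sup>2 = (1 - (cmod w)\<^sup>2) * (1 - (cmod z)\<^sup>2)"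
    unfolding cmod_power2 by (simp add: algebra_simps power2_eq_square)
  then show ?thesis
    using nz by (simp add: Moebius_function_simple norm_divide power_divide field_simps)
qed

text \<open>Moebius maps taking \<open>0\<close> to \<open>w\<close> and \<open>f w\<close> to
  \<open>0\<close> turn \<open>f\<close> into a map \<open>g\<close> fixing \<open>0\<close>; both
  estimates are the Schwarz lemma for \<open>g\<close>, once for its values and once for its
  derivative at \<open>0\<close>.\<close>

lemma Schwarz_Pick:
  assumes holf: "f holomorphic_on unit_disk" and im: "f ` unit_disk \<subseteq> unit_disk"
    and z: "z \<in> unit_disk" and w: "w \<in> unit_disk"
  shows "cmod (Moebius_function 0 (f w) (f z)) \<le> cmod (Moebius_function 0 w z)"
    and "(1 - (cmod w)\<^sup>2) * cmod (deriv f w) \<le> 1 - (cmod (f w))\<^sup>2"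
proof -
  define g where "g = Moebius_function 0 (f w) \<circ> (f \<circ> Moebius_function 0 (-w))"
  have fw: "cmod (f w) < 1" and w1: "cmod w < 1" and z1: "cmod z < 1"
    using im w z by (auto simp: image_subset_iff)
  have im1: "Moebius_function 0 (-w) ` unit_disk \<subseteq> unit_disk"
    using Moebius_function_norm_lt_1 [of "-w"] w1 by auto
  have holg: "g holomorphic_on unit_disk"
    unfolding g_def
    apply (intro holomorphic_on_compose_gen [of _ _ _ unit_disk])
        apply (auto intro!: Moebius_function_holomorphic Moebius_function_norm_lt_1 holf w1 fw)
    using im im1 by (auto simp: image_subset_iff)
  have g0: "g 0 = 0"
    by (simp add: g_def Moebius_function_def)
  have g1: "cmod (g u) < 1" if "cmod u < 1" for u
    unfolding g_def o_def
    using im im1 that by (intro Moebius_function_norm_lt_1 fw) (auto simp: image_subset_iff)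
  have "g (Moebius_function 0 w z) = Moebius_function 0 (f w) (f z)"
    using Moebius_function_compose [of "-w" w z] w1 z1 by (simp add: g_def)
  then show "cmod (Moebius_function 0 (f w) (f z)) \<le> cmod (Moebius_function 0 w z)"
    using Schwarz_Lemma(1) [OF holg g0 g1 Moebius_function_norm_lt_1 [OF w1 z1, of 0]] by simp
  have nz: "1 - cnj (f w) * f w \<noteq> 0"
    using fw by (intro one_minus_cnj_mult_nonzero) auto
  have d1: "(Moebius_function 0 (f w) has_field_derivative 1 / (1 - cnj (f w) * f w)) (at (f w))"
    unfolding Moebius_function_def
    by (rule derivative_eq_intros refl nz | simp add: nz)+
  have d2: "(Moebius_function 0 (-w) has_field_derivative (1 - cnj w * w)) (at 0)"
    unfolding Moebius_function_def
    by (rule derivative_eq_intros refl | simp add: algebra_simps)+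
  have d3: "(f has_field_derivative deriv f w) (at (Moebius_function 0 (-w) 0))"
    using holomorphic_derivI [OF holf open_ball w] by (simp add: Moebius_function_of_zero)
  have "(g has_field_derivative (1 / (1 - cnj (f w) * f w) * (deriv f w * (1 - cnj w * w)))) (at 0)"
    unfolding g_def
    by (intro DERIV_chain d2 d3) (use d1 in \<open>simp add: Moebius_function_of_zero\<close>)
  then have "deriv g 0 = 1 / (1 - cnj (f w) * f w) * (deriv f w * (1 - cnj w * w))"
    by (rule DERIV_imp_deriv)
  moreover have "cmod (deriv g 0) \<le> 1"
    by (rule Schwarz_Lemma(2) [OF holg g0 g1, of 0]) auto
  moreover have eq: "1 - cnj u * u = complex_of_real (1 - (cmod u)\<^sup>2)" for u
    by (metis complex_norm_square mult.commute of_real_1 of_real_diff)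
  moreover have pos: "1 - (cmod (f w))\<^sup>2 > 0" "1 - (cmod w)\<^sup>2 > 0"
    using fw w1 by (simp_all add: abs_square_less_1)
  ultimately have "cmod (deriv f w) * (1 - (cmod w)\<^sup>2) / (1 - (cmod (f w))\<^sup>2) \<le> 1"
    by (simp only: eq norm_mult norm_divide norm_of_real) simp
  then show "(1 - (cmod w)\<^sup>2) * cmod (deriv f w) \<le> 1 - (cmod (f w))\<^sup>2"
    using pos by (simp add: field_simps)
qed

text \<open>The constant depends on \<rho> alone, so it serves all maps \<open>F t\<close>
  simultaneously.\<close>

lemma disk_self_map_Lipschitz:
  assumes holf: "f holomorphic_on unit_disk" and im: "f ` unit_disk \<subseteq> unit_disk"
    and "\<rho> < 1" and z: "z \<in> cball 0 \<rho>" and w: "w \<in> cball 0 \<rho>"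
  shows "cmod (f z - f w) \<le> cmod (z - w) / (1 - \<rho>\<^sup>2)"
proof -
  have \<rho>: "0 \<le> \<rho>"
    using z by (metis cball_eq_empty empty_iff not_le)
  have sub: "cball 0 \<rho> \<subseteq> unit_disk"
    using \<open>\<rho> < 1\<close> by auto
  have "1 - \<rho>\<^sup>2 > 0"
    using \<rho> \<open>\<rho> < 1\<close> by (simp add: abs_square_less_1)
  have "cmod (f z - f w) \<le> (1 / (1 - \<rho>\<^sup>2)) * cmod (z - w)"
  proof (rule field_differentiable_bound [OF convex_cball, where f' = "deriv f"])
    fix u :: complex assume u: "u \<in> cball 0 \<rho>"
    then have ud: "u \<in> unit_disk" using sub by auto
    show "(f has_field_derivative deriv f u) (at u within cball 0 \<rho>)"
      using holomorphic_derivI [OF holf open_ball ud] has_field_derivative_at_within by blast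
    have "(1 - \<rho>\<^sup>2) * cmod (deriv f u) \<le> (1 - (cmod u)\<^sup>2) * cmod (deriv f u)"
      using u \<rho> by (intro mult_right_mono) (auto intro: power_mono)
    also have "\<dots> \<le> 1 - (cmod (f u))\<^sup>2"
      by (rule Schwarz_Pick(2) [OF holf im ud ud])
    also have "\<dots> \<le> 1"
      by simp
    finally show "cmod (deriv f u) \<le> 1 / (1 - \<rho>\<^sup>2)"
      using \<open>1 - \<rho>\<^sup>2 > 0\<close> by (simp add: field_simps)
  qed (use z w in auto)
  then show ?thesis
    by simp
qed

text \<open>Along a trajectory only right derivatives are available, so the mean value theorem does
  not apply. Instead, for each slope \<epsilon> the set of times up to which \<open>\<phi>\<close>
  grows at most at rate \<epsilon> is closed and can be prolonged to the right, hence reaches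
  \<open>b\<close>; then \<epsilon> tends to \<open>0\<close>.\<close>

lemma right_derivative_zero_constant:
  fixes \<phi> :: "real \<Rightarrow> 'a::real_normed_vector"
  assumes cont: "continuous_on {0..} \<phi>"
    and der: "\<And>t. t \<ge> 0 \<Longrightarrow> ((\<lambda>s. (\<phi> (t + s) - \<phi> t) /\<^sub>R s) \<longlongrightarrow> 0) (at_right 0)"
    and "b \<ge> 0"
  shows "\<phi> b = \<phi> 0"
proof -
  have bound: "norm (\<phi> b - \<phi> 0) \<le> \<epsilon> * b" if "\<epsilon> > 0" for \<epsilon>
  proof (rule ccontr)
    assume neg: "\<not> norm (\<phi> b - \<phi> 0) \<le> \<epsilon> * b"
    define U where "U = {t \<in> {0..b}. norm (\<phi> t - \<phi> 0) \<le> \<epsilon> * t}"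
    have cU: "closed U"
      unfolding U_def
      by (intro closed_Collect_le continuous_closed_preimage continuous_intros
            continuous_on_closed_Collect_le continuous_on_subset [OF cont]) auto
    define A where "A = {t \<in> {0..b}. {0..t} \<subseteq> U}"
    define s where "s = Sup A"
    have A0: "0 \<in> A"
      using \<open>b \<ge> 0\<close> by (auto simp: A_def U_def)
    have bdd: "bdd_above A"
      by (rule bdd_aboveI [of _ b]) (auto simp: A_def)
    have s: "0 \<le> s" "s \<le> b"
      unfolding s_def using A0 cSup_upper [OF A0 bdd] by (auto intro!: cSup_least simp: A_def)
    have below: "t \<in> U" if "0 \<le> t" "t < s" for t
      using less_cSupD [of A t] A0 that unfolding s_def A_def by fastforce
    have "s \<in> U"
    proof (cases "s = 0")
      case True then show ?thesis using A0 by (auto simp: A_def)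
    next
      case False
      then have "closure {0..<s} = {0..s}" using s by simp
      moreover have "closure {0..<s} \<subseteq> U"
        using below by (intro closure_minimal cU) auto
      ultimately show ?thesis using s by auto
    qed
    have sb: "s < b"
      using neg \<open>s \<in> U\<close> s by (cases "s = b") (auto simp: U_def)
    have "\<forall>\<^sub>F x in at_right 0. norm ((\<phi> (s + x) - \<phi> s) /\<^sub>R x) < \<epsilon>"
      using der [OF s(1)] \<open>\<epsilon> > 0\<close> by (auto simp: tendsto_iff)
    then obtain d where d: "d > 0" "\<And>x. 0 < x \<Longrightarrow> x < d \<Longrightarrow> norm ((\<phi> (s + x) - \<phi> s) /\<^sub>R x) < \<epsilon>"
      unfolding eventually_at_right_field by auto
    have step: "s + x \<in> U" if "0 < x" "x < d" "s + x \<le> b" for x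
    proof -
      have "norm (\<phi> (s + x) - \<phi> s) \<le> \<epsilon> * x"
        using d(2) [OF that(1,2)] that unfolding norm_scaleR by (simp add: field_simps)
      moreover have "norm (\<phi> s - \<phi> 0) \<le> \<epsilon> * s"
        using \<open>s \<in> U\<close> by (simp add: U_def)
      ultimately have "norm (\<phi> (s + x) - \<phi> 0) \<le> \<epsilon> * (s + x)"
        using norm_triangle_ineq [of "\<phi> (s + x) - \<phi> s" "\<phi> s - \<phi> 0"] by (simp add: algebra_simps)
      then show ?thesis
        using that s by (simp add: U_def)
    qed
    define r where "r = min (d / 2) (b - s)"
    have r: "0 < r" "r < d" "s + r \<le> b"
      using \<open>d > 0\<close> sb by (auto simp: r_def)
    have "{0..s + r} \<subseteq> U"
    proof
      fix t assume "t \<in> {0..s + r}"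
      then consider "0 \<le> t" "t < s" | "t = s" | "0 < t - s" "t - s \<le> r"
        by fastforce
      then show "t \<in> U"
        using below \<open>s \<in> U\<close> step [of "t - s"] r by cases auto
    qed
    then have "s + r \<in> A"
      using r s by (auto simp: A_def)
    then show False
      using cSup_upper [OF _ bdd] r by (fastforce simp: s_def)
  qed
  have "norm (\<phi> b - \<phi> 0) \<le> 0"
  proof (rule field_le_epsilon)
    fix e :: real assume "e > 0"
    \<comment> \<open>Dividing by \<open>b + 1\<close> instead of \<open>b\<close> covers the case
      \<open>b = 0\<close>.\<close>
    then have "norm (\<phi> b - \<phi> 0) \<le> e / (b + 1) * b"
      using \<open>b \<ge> 0\<close> by (intro bound) auto
    also have "\<dots> \<le> e"
      using \<open>b \<ge> 0\<close> \<open>e > 0\<close> by (simp add: field_simps)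
    finally show "norm (\<phi> b - \<phi> 0) \<le> 0 + e" by simp
  qed
  then show ?thesis by simp
qed

section \<open>Parabolic automorphisms\<close>

lemma continuous_agree_on_closure:
  fixes f g :: "'a::topological_space \<Rightarrow> 'b::real_normed_vector"
  assumes "continuous_on (closure S) f" "continuous_on (closure S) g"
    and "\<And>x. x \<in> S \<Longrightarrow> f x = g x" and "x \<in> closure S"
  shows "f x = g x"
  using continuous_constant_on_closure [of S "\<lambda>x. f x - g x" 0 x] assms
  by (simp add: continuous_on_diff)

text \<open>After a Moebius map has moved the zero of \<open>g\<close> to the origin, the Schwarz
  lemma holds for \<open>k\<close> and for its inverse. Equality at the sample point
  \<open>1/2\<close> makes \<open>k\<close> a rotation.\<close>

lemma disk_automorphism_Moebius:
  assumes "disk_automorphism g"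
  obtains \<kappa> p where "cmod \<kappa> = 1" "cmod p < 1"
    "\<And>z. z \<in> unit_disk \<Longrightarrow> g z = \<kappa> * (z - p) / (1 - cnj p * z)"
proof -
  have holg: "g holomorphic_on unit_disk" and bij: "bij_betw g unit_disk unit_disk"
    using assms by (auto simp: disk_automorphism_def)
  then obtain p where p: "p \<in> unit_disk" "g p = 0"
    unfolding bij_betw_def by (metis centre_in_ball imageE zero_less_one)
  then have p1: "cmod p < 1" by simp
  let ?M = "Moebius_function 0 (-p)" and ?N = "Moebius_function 0 p"
  have M1: "cmod (?M z) < 1" and N1: "cmod (?N z) < 1" if "cmod z < 1" for z
    using p1 that by (auto intro: Moebius_function_norm_lt_1)
  have MN: "?M (?N z) = z" and NM: "?N (?M z) = z" if "cmod z < 1" for z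
    using Moebius_function_compose [of "-p" p z] Moebius_function_compose [of p "-p" z] p1 that
    by auto
  define k where "k = g \<circ> ?M"
  have holk: "k holomorphic_on unit_disk"
    unfolding k_def using p1 M1
    by (intro holomorphic_on_compose_gen [OF _ holg] Moebius_function_holomorphic) auto
  have bijM: "bij_betw ?M unit_disk unit_disk"
    by (rule bij_betw_byWitness [of _ ?N]) (use M1 N1 MN NM in auto)
  have bijk: "bij_betw k unit_disk unit_disk"
    unfolding k_def by (rule bij_betw_trans [OF bijM bij])
  then have injk: "inj_on k unit_disk" and imk: "k ` unit_disk = unit_disk"
    by (auto simp: bij_betw_def)
  obtain k' where k': "k' holomorphic_on k ` unit_disk" "\<And>z. z \<in> unit_disk \<Longrightarrow> k' (k z) = z"
    using holomorphic_has_inverse [OF holk open_ball injk] by metis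
  have k0: "k 0 = 0"
    using p by (simp add: k_def Moebius_function_of_zero)
  have k1: "cmod (k z) < 1" if "cmod z < 1" for z
    using imk that by (metis image_eqI mem_ball_0)
  have k'1: "cmod (k' z) < 1" if "cmod z < 1" for z
  proof -
    have "z \<in> k ` unit_disk" using imk that by simp
    then show ?thesis using k'(2) by auto
  qed
  have k'0: "k' 0 = 0"
    using k'(2) [of 0] k0 by simp
  have half: "cmod (1/2::complex) < 1" by (simp add: norm_divide)
  have "cmod (k (1/2)) \<le> cmod (1/2::complex)"
    by (rule Schwarz_Lemma(1) [OF holk k0 k1 half])
  moreover have "cmod (k' (k (1/2))) \<le> cmod (k (1/2))"
    using Schwarz_Lemma(1) [of k', OF _ k'0 k'1 k1 [OF half]] k'(1) imk by simp
  ultimately have "cmod (k (1/2)) = cmod (1/2::complex)"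
    using k'(2) [of "1/2"] half by simp
  then have "\<exists>z. cmod z < 1 \<and> z \<noteq> 0 \<and> cmod (k z) = cmod z"
    using half by (intro exI [of _ "1/2"]) auto
  then obtain \<kappa> where l: "\<And>z. cmod z < 1 \<Longrightarrow> k z = \<kappa> * z" "cmod \<kappa> = 1"
    using Schwarz_Lemma(3) [OF holk k0 k1 half] by metis
  show thesis
  proof
    fix z :: complex assume "z \<in> unit_disk"
    then have z: "cmod z < 1" by simp
    have "g z = k (?N z)"
      by (simp add: k_def MN z)
    then show "g z = \<kappa> * (z - p) / (1 - cnj p * z)"
      using l(1) [OF N1 [OF z]] by (simp add: Moebius_function_simple)
  qed (use l p1 in auto)
qed

text \<open>The fixed-point clause of \<open>parabolic_automorphism\<close> with the point made
  explicit, so that the fixed points of different members of a group can be compared.\<close>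

definition only_fixed_point :: "(complex \<Rightarrow> complex) \<Rightarrow> complex \<Rightarrow> bool" where
  "only_fixed_point g \<zeta> \<longleftrightarrow> (\<exists>h. continuous_on (cball 0 1) h \<and> (\<forall>z\<in>unit_disk. h z = g z) \<and>
      {z \<in> cball 0 1. h z = z} = {\<zeta>})"

text \<open>The continuous extensions commute on the closed disk, so \<open>h'\<close> maps the
  fixed-point set of \<open>h\<close> into itself. As this set is a singleton, its element is also
  fixed by \<open>h'\<close>.\<close>

lemma only_fixed_point_unique:
  assumes g: "only_fixed_point g \<zeta>" "g ` unit_disk \<subseteq> unit_disk"
    and g': "only_fixed_point g' \<zeta>'" "g' ` unit_disk \<subseteq> unit_disk"
    and comm: "\<And>z. z \<in> unit_disk \<Longrightarrow> g (g' z) = g' (g z)"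
  shows "\<zeta> = \<zeta>'"
proof -
  obtain h where h: "continuous_on (cball 0 1) h" "\<And>z. z \<in> unit_disk \<Longrightarrow> h z = g z"
    "{z \<in> cball 0 1. h z = z} = {\<zeta>}"
    using g unfolding only_fixed_point_def by auto
  obtain h' where h': "continuous_on (cball 0 1) h'" "\<And>z. z \<in> unit_disk \<Longrightarrow> h' z = g' z"
    "{z \<in> cball 0 1. h' z = z} = {\<zeta>'}"
    using g' unfolding only_fixed_point_def by auto
  have cl: "closure unit_disk = cball (0::complex) 1" by simp
  have "h ` closure unit_disk \<subseteq> cball 0 1" "h' ` closure unit_disk \<subseteq> cball 0 1"
    using h(1,2) h'(1,2) g(2) g'(2)
    by (intro image_closure_subset; force simp: image_subset_iff less_imp_le)+
  then have hc: "h ` cball 0 1 \<subseteq> cball 0 1" and h'c: "h' ` cball 0 1 \<subseteq> cball 0 1"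
    by simp_all
  have "h (h' z) = h' (h z)" if "z \<in> closure unit_disk" for z
  proof (rule continuous_agree_on_closure [OF _ _ _ that])
    show "continuous_on (closure unit_disk) (\<lambda>z. h (h' z))"
      using continuous_on_compose2 [OF h(1) h'(1) h'c] cl by simp
    show "continuous_on (closure unit_disk) (\<lambda>z. h' (h z))"
      using continuous_on_compose2 [OF h'(1) h(1) hc] cl by simp
    fix z assume "z \<in> unit_disk"
    then show "h (h' z) = h' (h z)"
      using comm [of z] h(2) h'(2) g g' by (simp add: image_subset_iff)
  qed
  then have comm': "h (h' z) = h' (h z)" if "z \<in> cball 0 1" for z
    using that cl by simp
  have z: "\<zeta> \<in> cball 0 1" "h \<zeta> = \<zeta>"
    using h(3) by auto
  then have "h' \<zeta> \<in> {z \<in> cball 0 1. h z = z}"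
    using comm' [of \<zeta>] h'c by (auto simp: image_subset_iff)
  then have "h' \<zeta> = \<zeta>"
    using h(3) by blast
  then have "\<zeta> \<in> {z \<in> cball 0 1. h' z = z}"
    using z by simp
  then show ?thesis
    using h'(3) by blast
qed

text \<open>The fixed points of \<open>\<kappa> (z - p) / (1 - cnj p z)\<close> are symmetric with respect to the circle,
  so a unique fixed point in the closed disk is a double root.\<close>

lemma parabolic_automorphism_translation:
  assumes aut: "disk_automorphism g" and ofp: "only_fixed_point g \<zeta>" and \<zeta>: "cmod \<zeta> = 1"
  obtains b where "Re b = 0"
    "\<And>z. z \<in> unit_disk \<Longrightarrow> 1 / (1 - cnj \<zeta> * g z) = 1 / (1 - cnj \<zeta> * z) + b"
proof -
  obtain \<kappa> p where l: "cmod \<kappa> = 1" and p: "cmod p < 1"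
    and g: "\<And>z. z \<in> unit_disk \<Longrightarrow> g z = \<kappa> * (z - p) / (1 - cnj p * z)"
    using disk_automorphism_Moebius [OF aut] by blast
  obtain h where h: "continuous_on (cball 0 1) h" "\<And>z. z \<in> unit_disk \<Longrightarrow> h z = g z"
    "{z \<in> cball 0 1. h z = z} = {\<zeta>}"
    using ofp unfolding only_fixed_point_def by auto
  have nz: "1 - cnj p * z \<noteq> 0" if "z \<in> cball 0 1" for z
    using one_minus_cnj_mult_nonzero [of p z] p that by simp
  have "h z = \<kappa> * (z - p) / (1 - cnj p * z)" if "z \<in> closure unit_disk" for z
  proof (rule continuous_agree_on_closure [OF _ _ _ that])
    show "continuous_on (closure unit_disk) (\<lambda>z. \<kappa> * (z - p) / (1 - cnj p * z))"
      using nz by (intro continuous_intros) auto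
  qed (use h g in auto)
  then have hM: "h z = \<kappa> * (z - p) / (1 - cnj p * z)" if "z \<in> cball 0 1" for z
    using that by simp
  have fixiff: "h z = z \<longleftrightarrow> cnj p * z\<^sup>2 + (\<kappa> - 1) * z - \<kappa> * p = 0" if "z \<in> cball 0 1" for z
    using nz [OF that] by (simp add: hM [OF that] divide_eq_eq) (auto simp: algebra_simps power2_eq_square)
  have "p \<noteq> 0"
  proof
    assume "p = 0"
    then have "h 0 = 0" by (simp add: hM)
    then have "0 \<in> {z \<in> cball 0 1. h z = z}" by simp
    then have "0 = \<zeta>" using h(3) by blast
    then show False using \<zeta> by auto
  qed
  have \<zeta>0: "\<zeta> \<noteq> 0" using \<zeta> by auto
  have inv: "cnj \<zeta> * \<zeta> = 1"
    using complex_norm_square [of \<zeta>] \<zeta> by (simp add: mult.commute)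
  have root: "cnj p * \<zeta>\<^sup>2 + (\<kappa> - 1) * \<zeta> - \<kappa> * p = 0"
    using h(3) fixiff [of \<zeta>] \<zeta> by auto
  \<comment> \<open>The second root of the quadratic in \<open>fixiff\<close>, by Vieta. It has
    modulus \<open>1\<close>, hence is again a fixed point in the closed disk and coincides with
    \<zeta>.\<close>
  define \<eta> where "\<eta> = - \<kappa> * p / (cnj p * \<zeta>)"
  have prod: "cnj p * (\<zeta> * \<eta>) = - \<kappa> * p"
    using \<zeta>0 \<open>p \<noteq> 0\<close> by (simp add: \<eta>_def)
  have sum: "cnj p * (\<zeta> + \<eta>) = 1 - \<kappa>"
  proof -
    have "\<zeta> * (cnj p * (\<zeta> + \<eta>)) = \<zeta> * (1 - \<kappa>)"
      using root prod by (simp add: algebra_simps power2_eq_square)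
    then show ?thesis using \<zeta>0 by simp
  qed
  have "cmod \<eta> = 1"
    using \<zeta> l \<open>p \<noteq> 0\<close> by (simp add: \<eta>_def norm_divide norm_mult)
  moreover have "cnj p * \<eta>\<^sup>2 + (\<kappa> - 1) * \<eta> - \<kappa> * p = 0"
  proof -
    have k1: "\<kappa> - 1 = - (cnj p * (\<zeta> + \<eta>))" and k2: "\<kappa> * p = - (cnj p * (\<zeta> * \<eta>))"
      unfolding sum prod by simp_all
    show ?thesis
      unfolding k1 k2 by (simp add: algebra_simps power2_eq_square)
  qed
  ultimately have "\<eta> \<in> {z \<in> cball 0 1. h z = z}"
    using fixiff [of \<eta>] by simp
  then have "\<eta> = \<zeta>" using h(3) by blast
  define q where "q = cnj p * \<zeta>"
  have lq: "\<kappa> = 1 - 2 * q"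
    using sum \<open>\<eta> = \<zeta>\<close> by (simp add: q_def algebra_simps)
  have lp: "\<kappa> * p = - q * \<zeta>"
    using prod \<open>\<eta> = \<zeta>\<close> by (simp add: q_def mult.assoc)
  have "1 - q \<noteq> 0"
    using nz [of \<zeta>] \<zeta> by (simp add: q_def)
  have p_eq: "cnj p = q * cnj \<zeta>"
    using inv by (simp add: q_def mult.assoc mult.commute [of \<zeta>])
  \<comment> \<open>The condition \<open>cmod \<kappa> = 1\<close> becomes
    \<open>Re q = cmod q ^ 2\<close>, which says exactly that the translation
    \<open>q / (1 - q)\<close> is imaginary.\<close>
  have "(cmod (1 - 2 * q))\<^sup>2 = 1"
    using l lq by simp
  then have Req: "Re q = (cmod q)\<^sup>2"
    unfolding cmod_power2 by (simp add: power2_eq_square algebra_simps)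
  show thesis
  proof
    have "Re q * Re (1 - q) + Im q * Im (1 - q) = Re q - (cmod q)\<^sup>2"
      unfolding cmod_power2 by (simp add: power2_eq_square algebra_simps)
    then show "Re (q / (1 - q)) = 0"
      using Req unfolding Re_divide' by simp
    fix z assume z: "z \<in> unit_disk"
    then have nzz: "1 - cnj p * z \<noteq> 0"
      using nz [of z] by simp
    have "cmod (cnj \<zeta> * z) \<noteq> 1"
      using z \<zeta> by (simp add: norm_mult)
    then have z1: "1 - cnj \<zeta> * z \<noteq> 0"
      by (metis eq_iff_diff_eq_0 norm_one)
    have "cnj \<zeta> * (\<kappa> * p) = - q * (cnj \<zeta> * \<zeta>)"
      unfolding lp by (simp only: mult_ac)
    then have lp': "cnj \<zeta> * (\<kappa> * p) = - q"
      using inv by simp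
    have "1 - cnj \<zeta> * g z = (1 - cnj p * z - cnj \<zeta> * \<kappa> * z + cnj \<zeta> * (\<kappa> * p)) / (1 - cnj p * z)"
      unfolding g [OF z] eq_divide_eq using nzz by (simp add: left_diff_distrib) (simp add: algebra_simps)
    also have "1 - cnj p * z - cnj \<zeta> * \<kappa> * z + cnj \<zeta> * (\<kappa> * p) = (1 - q) * (1 - cnj \<zeta> * z)"
      unfolding lp' unfolding p_eq lq by (simp add: algebra_simps)
    finally have "1 / (1 - cnj \<zeta> * g z) = (1 - cnj p * z) / ((1 - q) * (1 - cnj \<zeta> * z))"
      by simp
    also have "1 - cnj p * z = (1 - q) + q * (1 - cnj \<zeta> * z)"
      by (simp add: p_eq algebra_simps)
    also have "((1 - q) + q * (1 - cnj \<zeta> * z)) / ((1 - q) * (1 - cnj \<zeta> * z)) = 1 / (1 - cnj \<zeta> * z) + q / (1 - q)"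
      using z1 \<open>1 - q \<noteq> 0\<close> by (simp add: add_divide_distrib)
    finally show "1 / (1 - cnj \<zeta> * g z) = 1 / (1 - cnj \<zeta> * z) + q / (1 - q)" .
  qed
qed

section \<open>Semigroups and their generators\<close>

locale disk_semigroup =
  fixes F :: "real \<Rightarrow> complex \<Rightarrow> complex" and f :: "complex \<Rightarrow> complex"
  assumes semigroup: "continuous_semigroup F"
    and generator: "generated_by F f"
    and Denjoy_Wolff: "denjoy_wolff_at_1 F"
begin

lemma holo: "t \<ge> 0 \<Longrightarrow> F t holomorphic_on unit_disk"
  and maps: "t \<ge> 0 \<Longrightarrow> F t ` unit_disk \<subseteq> unit_disk"
  and F_zero: "z \<in> unit_disk \<Longrightarrow> F 0 z = z"
  and F_add: "t \<ge> 0 \<Longrightarrow> s \<ge> 0 \<Longrightarrow> z \<in> unit_disk \<Longrightarrow> F (t + s) z = F t (F s z)"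
  and F_at_zero: "z \<in> unit_disk \<Longrightarrow> ((\<lambda>t. F t z) \<longlongrightarrow> z) (at_right 0)"
  using semigroup by (auto simp: continuous_semigroup_def)

lemma F_in: "t \<ge> 0 \<Longrightarrow> z \<in> unit_disk \<Longrightarrow> F t z \<in> unit_disk"
  using maps by blast

lemma F_generator: "z \<in> unit_disk \<Longrightarrow> ((\<lambda>t. (z - F t z) / of_real t) \<longlongrightarrow> f z) (at_right 0)"
  using generator by (simp add: generated_by_def)

lemma F_tendsto_1: "z \<in> unit_disk \<Longrightarrow> ((\<lambda>t. F t z) \<longlongrightarrow> 1) at_top"
  using Denjoy_Wolff by (simp add: denjoy_wolff_at_1_def)

text \<open>Since \<open>F (t + s) z = F t (F s z)\<close>, the common Lipschitz constant of the
  maps \<open>F t\<close> transports right continuity at \<open>0\<close> to every \<open>t\<close>,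
  with a step size independent of \<open>t\<close>. This uniformity also gives continuity from the
  left.\<close>

lemma trajectory_continuous:
  assumes z: "z \<in> unit_disk"
  shows "continuous_on {0..} (\<lambda>t. F t z)"
proof -
  define \<rho> where "\<rho> = (1 + cmod z) / 2"
  have \<rho>: "\<rho> < 1" "cmod z < \<rho>" "\<rho> > 0"
    using z by (auto simp: \<rho>_def add_pos_nonneg)
  have pos: "1 - \<rho>\<^sup>2 > 0"
    using \<rho> by (simp add: abs_square_less_1)
  have "\<exists>d>0. \<forall>t\<ge>0. \<forall>s. 0 \<le> s \<and> s < d \<longrightarrow> cmod (F (t + s) z - F t z) < \<epsilon>" if "\<epsilon> > 0" for \<epsilon>
  proof -
    have "\<forall>\<^sub>F s in at_right 0. dist (F s z) z < min (\<rho> - cmod z) (\<epsilon> * (1 - \<rho>\<^sup>2))"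
      using tendstoD [OF F_at_zero [OF z], of "min (\<rho> - cmod z) (\<epsilon> * (1 - \<rho>\<^sup>2))"] \<rho> pos that
      by simp
    then obtain d where d: "d > 0"
      "\<And>s. 0 < s \<Longrightarrow> s < d \<Longrightarrow> dist (F s z) z < min (\<rho> - cmod z) (\<epsilon> * (1 - \<rho>\<^sup>2))"
      unfolding eventually_at_right_field by auto
    have "cmod (F (t + s) z - F t z) < \<epsilon>" if "t \<ge> 0" "0 \<le> s" "s < d" for t s
    proof (cases "s = 0")
      case True then show ?thesis using \<open>\<epsilon> > 0\<close> by simp
    next
      case False
      then have *: "cmod (F s z - z) < \<rho> - cmod z" "cmod (F s z - z) < \<epsilon> * (1 - \<rho>\<^sup>2)"
        using d(2) [of s] that by (auto simp: dist_norm)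
      have "F s z \<in> cball 0 \<rho>"
        using *(1) norm_triangle_ineq2 [of "F s z" z] by simp
      then have "cmod (F t (F s z) - F t z) \<le> cmod (F s z - z) / (1 - \<rho>\<^sup>2)"
        using \<rho> that by (intro disk_self_map_Lipschitz holo maps) auto
      also have "\<dots> < \<epsilon>"
        using *(2) pos by (simp add: divide_less_eq)
      finally show ?thesis
        using F_add that z by simp
    qed
    then show ?thesis using d(1) by blast
  qed
  note key = this
  show ?thesis
    unfolding continuous_on_iff
  proof (intro ballI allI impI)
    fix t \<epsilon> :: real assume "t \<in> {0..}" "\<epsilon> > 0"
    obtain d where d: "d > 0"
      "\<And>t s. t \<ge> 0 \<Longrightarrow> 0 \<le> s \<Longrightarrow> s < d \<Longrightarrow> cmod (F (t + s) z - F t z) < \<epsilon>"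
      using key [OF \<open>\<epsilon> > 0\<close>] by blast
    have "dist (F u z) (F t z) < \<epsilon>" if "u \<ge> 0" "dist u t < d" for u
      using d(2) [of t "u - t"] d(2) [of u "t - u"] that \<open>t \<in> {0..}\<close>
      by (cases "t \<le> u") (auto simp: dist_norm norm_minus_commute)
    then show "\<exists>d>0. \<forall>u\<in>{0..}. dist u t < d \<longrightarrow> dist (F u z) (F t z) < \<epsilon>"
      using d(1) by auto
  qed
qed

text \<open>A failure produces times \<open>s n\<close> tending to \<open>0\<close> and bad points
  \<open>z n\<close>. Montel's theorem gives a locally uniform limit of a subsequence of
  \<open>F (s n)\<close>, and pointwise this limit is the identity.\<close>

lemma locally_uniform_at_zero:
  assumes \<rho>: "\<rho> < 1" and "\<epsilon> > 0"
  obtains d where "d > 0" "\<And>s z. 0 \<le> s \<Longrightarrow> s \<le> d \<Longrightarrow> z \<in> cball 0 \<rho> \<Longrightarrow> cmod (F s z - z) \<le> \<epsilon>"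
proof (rule ccontr)
  assume neg: "\<not> thesis"
  have sub: "cball 0 \<rho> \<subseteq> unit_disk" using \<rho> by auto
  have "\<exists>s z. 0 \<le> s \<and> s \<le> 1 / Suc n \<and> z \<in> cball 0 \<rho> \<and> \<not> cmod (F s z - z) \<le> \<epsilon>" for n
    using neg that [of "1 / Suc n"] by fastforce
  then obtain s z where s: "\<And>n. 0 \<le> s n" "\<And>n. s n \<le> 1 / Suc n"
    and z: "\<And>n. z n \<in> cball 0 \<rho>" and big: "\<And>n. \<not> cmod (F (s n) (z n) - z n) \<le> \<epsilon>"
    by metis
  have snz: "0 < s n" for n
    using F_zero [of "z n"] z [of n] sub big [of n] s(1) [of n] \<open>\<epsilon> > 0\<close>
    by (cases "s n = 0") (auto simp: less_le)
  have "s \<longlonglongrightarrow> 0"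
    by (rule tendsto_sandwich [OF _ _ tendsto_const LIMSEQ_inverse_real_of_nat])
      (use s in \<open>auto simp: inverse_eq_divide\<close>)
  then have s0: "filterlim s (at_right 0) sequentially"
    using snz by (auto simp: filterlim_at less_imp_neq [symmetric])
  obtain g r where g: "strict_mono (r :: nat \<Rightarrow> nat)"
      "\<And>x. x \<in> unit_disk \<Longrightarrow> ((\<lambda>n. F (s (r n)) x) \<longlongrightarrow> g x) sequentially"
      "\<And>K. compact K \<Longrightarrow> K \<subseteq> unit_disk \<Longrightarrow> uniform_limit K ((\<lambda>n. F (s n)) \<circ> r) g sequentially"
  proof (rule Montel [of unit_disk "{k. k holomorphic_on unit_disk \<and> k ` unit_disk \<subseteq> unit_disk}" "\<lambda>n. F (s n)"])
    fix K :: "complex set" assume K: "compact K" "K \<subseteq> unit_disk"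
    show "\<exists>B. \<forall>h\<in>{k. k holomorphic_on unit_disk \<and> k ` unit_disk \<subseteq> unit_disk}. \<forall>z\<in>K. cmod (h z) \<le> B"
    proof (intro exI ballI)
      fix h x assume "h \<in> {k. k holomorphic_on unit_disk \<and> k ` unit_disk \<subseteq> unit_disk}" "x \<in> K"
      then have "h x \<in> unit_disk" using K by blast
      then show "cmod (h x) \<le> 1" by simp
    qed
  next
    show "range (\<lambda>n. F (s n)) \<subseteq> {k. k holomorphic_on unit_disk \<and> k ` unit_disk \<subseteq> unit_disk}"
      using holo maps s by blast
  qed auto
  have gid: "g x = x" if x: "x \<in> unit_disk" for x
  proof (rule LIMSEQ_unique [OF g(2) [OF x]])
    have "filterlim (\<lambda>n. s (r n)) (at_right 0) sequentially"
      using filterlim_compose [OF s0 filterlim_subseq [OF g(1)]] by simp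
    then show "(\<lambda>n. F (s (r n)) x) \<longlonglongrightarrow> x"
      by (rule filterlim_compose [OF F_at_zero [OF x]])
  qed
  have "uniform_limit (cball 0 \<rho>) ((\<lambda>n. F (s n)) \<circ> r) g sequentially"
    by (rule g(3) [OF compact_cball sub])
  then have "\<forall>\<^sub>F n in sequentially. \<forall>x\<in>cball 0 \<rho>. dist (F (s (r n)) x) (g x) < \<epsilon>"
    using \<open>\<epsilon> > 0\<close> by (auto simp: uniform_limit_iff)
  then obtain n where "\<forall>x\<in>cball 0 \<rho>. dist (F (s (r n)) x) (g x) < \<epsilon>"
    by (auto simp: eventually_sequentially)
  then have "dist (F (s (r n)) (z (r n))) (z (r n)) < \<epsilon>"
    using z [of "r n"] gid [of "z (r n)"] sub by (metis subsetD)
  then show False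
    using big [of "r n"] by (simp add: dist_norm)
qed

text \<open>The Riemann sums \<open>S = h * (\<Sum>k<N. F (k h))\<close> satisfy \<open>S (F h z) - S z = h (F (N h) z - z)\<close>,
  and for small \<open>N h\<close> the map \<open>S / (N h)\<close> is close to the identity, hence expands distances by
  a factor at least \<open>1/2\<close>.\<close>

lemma displacement_bound:
  assumes \<rho>: "0 \<le> \<rho>" "\<rho> < 1"
  obtains d C where "d > 0" "\<And>s z. 0 < s \<Longrightarrow> s \<le> d \<Longrightarrow> z \<in> cball 0 \<rho> \<Longrightarrow> cmod (F s z - z) \<le> C * s"
proof -
  \<comment> \<open>Two margins of width \<open>e\<close>: \<open>F h z\<close> stays within the
    first, and Cauchy's inequality on disks of radius \<open>e\<close> uses the second. There the
    bound \<open>e / 2\<close> on the error \<open>E\<close> becomes \<open>1 / 2\<close> for its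
    derivative.\<close>
  define e where "e = (1 - \<rho>) / 3"
  have e: "e > 0" "\<rho> + 2 * e < 1"
    using \<rho> by (auto simp: e_def field_simps)
  obtain d where d: "d > 0"
    "\<And>s z. 0 \<le> s \<Longrightarrow> s \<le> d \<Longrightarrow> z \<in> cball 0 (\<rho> + 2 * e) \<Longrightarrow> cmod (F s z - z) \<le> e / 2"
    using locally_uniform_at_zero [OF e(2), of "e / 2"] e by auto
  \<comment> \<open>The constant \<open>8\<close> is a product of three factors \<open>2\<close>:
    the expansion estimate, the diameter of the disk, and \<open>d < 2 * \<tau>\<close> for the
    largest multiple \<open>\<tau>\<close> of \<open>h\<close> not exceeding
    \<open>d\<close>.\<close>
  have "cmod (F h z - z) \<le> (8 / d) * h" if h: "0 < h" "h \<le> d" and z: "z \<in> cball 0 \<rho>" for h z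
  proof -
    define N where "N = nat \<lfloor>d / h\<rfloor>"
    define \<tau> where "\<tau> = N * h"
    have dh: "d / h \<ge> 1" using h by simp
    have "real N = of_int \<lfloor>d / h\<rfloor>"
      using dh by (simp add: N_def)
    then have N: "real N \<le> d / h" "d / h < real N + 1"
      by linarith+
    then have N1: "1 \<le> N" using dh by linarith
    have \<tau>: "\<tau> \<le> d" "d < 2 * \<tau>" "\<tau> > 0"
    proof -
      show "\<tau> \<le> d" using N(1) h by (simp add: \<tau>_def field_simps)
      have "d < (real N + 1) * h" using N(2) h by (simp add: field_simps)
      also have "\<dots> \<le> 2 * N * h" using N1 h by (intro mult_right_mono) auto
      finally show "d < 2 * \<tau>" by (simp add: \<tau>_def)
      then show "\<tau> > 0" using d(1) by linarith
    qed
    define E where "E w = (\<Sum>k<N. F (k * h) w - w) / of_nat N" for w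
    define S where "S w = h * (\<Sum>k<N. F (k * h) w)" for w
    have kh: "0 \<le> real k * h" "real k * h \<le> d" if "k < N" for k
    proof -
      have "real k * h \<le> N * h" using that h by (intro mult_right_mono) auto
      then show "0 \<le> real k * h" "real k * h \<le> d" using \<tau>(1) h unfolding \<tau>_def by (simp, linarith)
    qed
    have SE: "S w = \<tau> * (w + E w)" for w
    proof -
      have "E w = (\<Sum>k<N. F (k * h) w) / of_nat N - w"
        using N1 by (simp add: E_def sum_subtractf diff_divide_distrib)
      then show ?thesis
        using N1 by (simp add: S_def \<tau>_def)
    qed
    have holE: "E holomorphic_on unit_disk"
      unfolding E_def using N1 kh by (intro holomorphic_intros holo) auto
    have boundE: "cmod (E w) \<le> e / 2" if "w \<in> cball 0 (\<rho> + 2 * e)" for w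
    proof -
      have "cmod (\<Sum>k<N. F (k * h) w - w) \<le> of_nat (card {..<N}) * (e / 2)"
        using kh d(2) that by (intro sum_norm_bound) auto
      then show ?thesis
        using N1 by (simp add: E_def norm_divide field_simps)
    qed
    have dE: "cmod (deriv E w) \<le> 1 / 2" if "w \<in> cball 0 (\<rho> + e)" for w
    proof -
      have sub: "cball w e \<subseteq> cball 0 (\<rho> + 2 * e)"
      proof
        fix x assume "x \<in> cball w e"
        then have "cmod (x - w) \<le> e" by (simp add: dist_norm norm_minus_commute)
        then show "x \<in> cball 0 (\<rho> + 2 * e)"
          using that norm_triangle_sub [of x w] by simp
      qed
      then have sub': "cball w e \<subseteq> unit_disk" using e by auto
      have "cmod ((deriv ^^ 1) E w) \<le> fact 1 * (e / 2) / e ^ 1"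
      proof (rule Cauchy_inequality)
        show "E holomorphic_on ball w e"
          using sub' by (intro holomorphic_on_subset [OF holE]) auto
        show "continuous_on (cball w e) E"
          using sub' holE holomorphic_on_imp_continuous_on continuous_on_subset by blast
        show "cmod (E x) \<le> e / 2" if "cmod (w - x) = e" for x
          using sub that by (intro boundE) (auto simp: dist_norm subset_iff)
      qed (use e in auto)
      then show ?thesis using e by simp
    qed
    have Fh: "F h z \<in> cball 0 (\<rho> + e)"
    proof -
      have "cmod (F h z - z) \<le> e / 2"
        using d(2) [of h z] h z e by auto
      then show ?thesis
        using z e norm_triangle_ineq2 [of "F h z" z] by simp
    qed
    have z': "z \<in> cball 0 (\<rho> + e)" using z e by auto
    have "cmod (E (F h z) - E z) \<le> 1 / 2 * cmod (F h z - z)"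
    proof (rule field_differentiable_bound [OF convex_cball _ dE Fh z'])
      fix u :: complex assume "u \<in> cball 0 (\<rho> + e)"
      then have "u \<in> unit_disk" using e by auto
      then show "(E has_field_derivative deriv E u) (at u within cball 0 (\<rho> + e))"
        using holomorphic_derivI [OF holE open_ball] has_field_derivative_at_within by blast
    qed
    then have "cmod (F h z - z) \<le> 2 * cmod ((F h z + E (F h z)) - (z + E z))"
      using norm_triangle_ineq2 [of "F h z - z" "E z - E (F h z)"]
      by (simp add: algebra_simps norm_minus_commute)
    also have "(F h z + E (F h z)) - (z + E z) = (S (F h z) - S z) / \<tau>"
    proof -
      have "S (F h z) - S z = \<tau> * ((F h z + E (F h z)) - (z + E z))"
        by (simp only: SE right_diff_distrib)
      then show ?thesis using \<tau>(3) by simp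
    qed
    also have "S (F h z) - S z = h * (F \<tau> z - z)"
    proof -
      have zd: "z \<in> unit_disk" using z \<rho> by auto
      have "F (real k * h) (F h z) = F (real (Suc k) * h) z" for k
        using F_add [of "real k * h" h z] zd h by (simp add: algebra_simps)
      then have "S (F h z) - S z = h * (\<Sum>k<N. F (real (Suc k) * h) z - F (real k * h) z)"
        unfolding S_def by (simp only: sum_subtractf right_diff_distrib)
      also have "(\<Sum>k<N. F (real (Suc k) * h) z - F (real k * h) z) = F (real N * h) z - F (real 0 * h) z"
        by (rule sum_lessThan_telescope)
      finally show ?thesis
        using F_zero [OF zd] by (simp add: \<tau>_def)
    qed
    finally have "cmod (F h z - z) \<le> 2 * (h * cmod (F \<tau> z - z) / \<tau>)"
      using h \<tau> by (simp add: norm_mult norm_divide)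
    also have "\<dots> \<le> 2 * (h * 2 / \<tau>)"
    proof -
      have zd: "z \<in> unit_disk" using z \<rho> by auto
      have "F \<tau> z \<in> unit_disk" using zd \<tau> by (intro F_in) auto
      then have "cmod (F \<tau> z - z) \<le> 2"
        using zd norm_triangle_ineq4 [of "F \<tau> z" z] by simp
      then show ?thesis
        using h \<tau> by (intro mult_left_mono divide_right_mono) auto
    qed
    also have "\<dots> \<le> (8 / d) * h"
      using h \<tau> d(1) by (simp add: field_simps)
    finally show ?thesis .
  qed
  then show thesis
    using that d(1) by blast
qed

end

section \<open>Univalence criteria and the half-plane coordinate\<close>

text \<open>The Noshiro-Warschawski criterion. The factor \<open>k\<close> allows the derivative to
  lie in any open half-plane whose boundary passes through \<open>0\<close>.\<close>

lemma inj_on_if_Re_deriv_pos: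
  assumes "convex S" and der: "\<And>z. z \<in> S \<Longrightarrow> (g has_field_derivative g' z) (at z)"
    and pos: "\<And>z. z \<in> S \<Longrightarrow> 0 < Re (k * g' z)"
  shows "inj_on g S"
proof (rule inj_onI, rule ccontr)
  fix u v assume uv: "u \<in> S" "v \<in> S" "g u = g v" "u \<noteq> v"
  have seg: "closed_segment u v \<subseteq> S"
    using uv \<open>convex S\<close> by (simp add: closed_segment_subset)
  \<comment> \<open>Division by \<open>v - u\<close> normalises the direction of the segment, so
    that the mean value theorem produces \<open>Re (k * g' x)\<close> itself.\<close>
  have "\<exists>x. x \<in> closed_segment u v \<and>
      Re (k / (v - u) * g v) - Re (k / (v - u) * g u) = Re (k / (v - u) * g' x * (v - u))"
    using seg by (intro complex_mvt_line DERIV_cmult der) auto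
  then obtain x where x: "x \<in> closed_segment u v"
    "Re (k / (v - u) * g v) - Re (k / (v - u) * g u) = Re (k / (v - u) * g' x * (v - u))"
    by blast
  then have "Re (k * g' x) = 0"
    using uv by simp
  then show False
    using pos [of x] x seg by auto
qed

text \<open>Wolff's lemma gives only a weak inequality, with equality throughout for parabolic
  automorphisms. By the open mapping theorem, a zero of \<open>Re (g' x)\<close> forces
  \<open>g'\<close> to be a constant \<open>c\<close>, and then the factor \<open>cnj c\<close>
  restores strictness.\<close>

lemma inj_on_if_Re_deriv_nonneg:
  assumes "convex S" "open S" and der: "\<And>z. z \<in> S \<Longrightarrow> (g has_field_derivative g' z) (at z)"
    and nn: "\<And>z. z \<in> S \<Longrightarrow> 0 \<le> Re (g' z)" and nz: "\<And>z. z \<in> S \<Longrightarrow> g' z \<noteq> 0"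
  shows "inj_on g S"
proof (cases "\<forall>z\<in>S. 0 < Re (g' z)")
  case True
  then show ?thesis
    using inj_on_if_Re_deriv_pos [OF assms(1) der, of 1] by simp
next
  case False
  then obtain x where x: "x \<in> S" "Re (g' x) = 0"
    using nn by force
  have holg: "g holomorphic_on S"
    using der \<open>open S\<close> by (auto simp: holomorphic_on_open)
  have "deriv g holomorphic_on S"
    by (rule holomorphic_deriv [OF holg \<open>open S\<close>])
  then have holg': "g' holomorphic_on S"
    by (rule holomorphic_transform) (use der in \<open>auto intro: DERIV_imp_deriv\<close>)
  have "g' constant_on S"
  proof (rule ccontr)
    assume "\<not> g' constant_on S"
    then have "open (g' ` S)"
      using \<open>open S\<close> convex_connected [OF \<open>convex S\<close>] by (intro open_mapping_thm [OF holg']) auto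
    then obtain e where e: "e > 0" "cball (g' x) e \<subseteq> g' ` S"
      using x open_contains_cball by blast
    have "g' x - of_real e \<in> cball (g' x) e"
      using e by (simp add: dist_norm)
    then obtain y where "y \<in> S" "g' y = g' x - of_real e"
      using e by (metis imageE subsetD)
    then show False
      using nn [of y] x e by simp
  qed
  then obtain c where c: "\<And>z. z \<in> S \<Longrightarrow> g' z = c"
    by (auto simp: constant_on_def)
  then have "c \<noteq> 0" using nz x by metis
  then have "0 < Re (cnj c * c)"
    by (simp add: complex_neq_0 flip: power2_eq_square)
  then show ?thesis
    using inj_on_if_Re_deriv_pos [OF assms(1) der, of "cnj c"] c by simp
qed

text \<open>The left side is the Poisson kernel at \<open>1\<close>, whose superlevel sets are the
  horodisks; the coordinate \<open>1 / (1 - z)\<close> turns them into half-planes.\<close>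

lemma horodisk_Re_eq:
  assumes "z \<noteq> 1"
  shows "(1 - (cmod z)\<^sup>2) / (cmod (1 - z))\<^sup>2 = 2 * Re (1 / (1 - z)) - 1"
proof -
  have "(cmod (1 - z))\<^sup>2 \<noteq> 0" using assms by simp
  moreover have "Re (1 / (1 - z)) = Re (1 - z) / (cmod (1 - z))\<^sup>2"
    unfolding Re_divide' by simp
  moreover have "1 - (cmod z)\<^sup>2 = 2 * Re (1 - z) - (cmod (1 - z))\<^sup>2"
    unfolding cmod_power2 by (simp add: power2_eq_square algebra_simps)
  ultimately show ?thesis
    by (simp only: diff_divide_distrib) simp
qed

lemma disk_Re_gt_half:
  assumes "z \<in> unit_disk"
  shows "1 / 2 < Re (1 / (1 - z))"
proof -
  have "z \<noteq> 1" using assms by auto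
  moreover from this have "0 < (1 - (cmod z)\<^sup>2) / (cmod (1 - z))\<^sup>2"
    using assms by (intro divide_pos_pos) (auto simp: abs_square_less_1)
  ultimately show ?thesis
    using horodisk_Re_eq [of z] by linarith
qed

lemma half_plane_to_disk:
  fixes u :: complex
  assumes "1 / 2 < Re u"
  shows "1 - 1 / u \<in> unit_disk"
proof -
  have nz: "u \<noteq> 0" using assms by auto
  have "(cmod (u - 1))\<^sup>2 < (cmod u)\<^sup>2"
    using assms unfolding cmod_power2 by (simp add: power2_eq_square algebra_simps)
  then have "cmod (u - 1) < cmod u" by (rule power_less_imp_less_base) simp
  moreover have "1 - 1 / u = (u - 1) / u" using nz by (simp add: diff_divide_distrib)
  ultimately show ?thesis using nz by (simp add: norm_divide)
qed

section \<open>Holomorphy and zeros of the generator, Wolff's lemma\<close>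

context disk_semigroup
begin

text \<open>Caratheodory's form of the derivative avoids dividing by \<open>F s w - w\<close>, which
  might vanish.\<close>

lemma chain_rule_at_zero:
  assumes w: "w \<in> unit_disk" and g: "(g has_field_derivative c) (at w)"
  shows "((\<lambda>s. (g (F s w) - g w) / of_real s) \<longlongrightarrow> - c * f w) (at_right 0)"
proof -
  obtain D where D: "\<And>z. g z - g w = D z * (z - w)" "isCont D w" "D w = c"
    using g unfolding CARAT_DERIV by blast
  have "((\<lambda>s. D (F s w)) \<longlongrightarrow> D w) (at_right 0)"
    by (rule isCont_tendsto_compose [OF D(2) F_at_zero [OF w]])
  then have "((\<lambda>s. D (F s w) * (- ((w - F s w) / of_real s))) \<longlongrightarrow> D w * (- f w)) (at_right 0)"
    by (intro tendsto_intros F_generator w)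
  then show ?thesis
    using D by (simp add: minus_divide_left)
qed

text \<open>The difference quotients at the times \<open>1 / Suc n\<close> are locally bounded, by
  \<open>displacement_bound\<close> for times up to \<open>d\<close> and by \<open>2 / d\<close>
  otherwise. Montel's theorem then makes a subsequential limit holomorphic, and pointwise this limit
  is \<open>f\<close>.\<close>

lemma generator_holomorphic: "f holomorphic_on unit_disk"
proof -
  define q where "q n z = (z - F (1 / Suc n) z) * of_nat (Suc n)" for n z
  obtain g r where g: "g holomorphic_on unit_disk" "strict_mono (r :: nat \<Rightarrow> nat)"
      "\<And>x. x \<in> unit_disk \<Longrightarrow> ((\<lambda>n. q (r n) x) \<longlongrightarrow> g x) sequentially"
  proof (rule Montel [of unit_disk "range q" q])
    show "h holomorphic_on unit_disk" if "h \<in> range q" for h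
      using that unfolding q_def by (auto intro!: holomorphic_intros holo)
    fix K :: "complex set" assume K: "compact K" "K \<subseteq> unit_disk"
    obtain \<rho> where \<rho>: "0 \<le> \<rho>" "\<rho> < 1" "K \<subseteq> cball 0 \<rho>"
    proof (cases "K = {}")
      case True then show ?thesis using that [of 0] by simp
    next
      case False
      obtain x where x: "x \<in> K" "\<And>y. y \<in> K \<Longrightarrow> cmod y \<le> cmod x"
        using continuous_attains_sup [OF K(1) False, of cmod] by (auto intro: continuous_intros)
      moreover have "cmod x < 1" using x(1) K by auto
      moreover have "K \<subseteq> cball 0 (cmod x)" using x(2) by auto
      ultimately show ?thesis using that [of "cmod x"] by simp
    qed
    obtain d C where d: "d > 0" "\<And>s z. 0 < s \<Longrightarrow> s \<le> d \<Longrightarrow> z \<in> cball 0 \<rho> \<Longrightarrow> cmod (F s z - z) \<le> C * s"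
      using displacement_bound [OF \<rho>(1,2)] by blast
    have "cmod (q n z) \<le> max C (2 / d)" if "z \<in> K" for n z
    proof (cases "1 / Suc n \<le> d")
      case True
      have "cmod (F (1 / Suc n) z - z) \<le> C * (1 / Suc n)"
        using d(2) [of "1 / Suc n" z] True that \<rho> by (simp add: subset_iff)
      then have "cmod (z - F (1 / Suc n) z) * real (Suc n) \<le> C"
        by (simp add: norm_minus_commute [of z] pos_le_divide_eq del: of_nat_Suc)
      then have "cmod (q n z) \<le> C"
        unfolding q_def norm_mult norm_of_nat .
      then show ?thesis by simp
    next
      case False
      have zd: "z \<in> unit_disk" using that K by auto
      have "F (1 / Suc n) z \<in> unit_disk" using zd by (intro F_in) auto
      then have "cmod (z - F (1 / Suc n) z) \<le> 2"
        using zd norm_triangle_ineq4 [of z "F (1 / Suc n) z"] by simp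
      then have "cmod (q n z) \<le> 2 * real (Suc n)"
        unfolding q_def norm_mult norm_of_nat by (intro mult_right_mono) auto
      also have "\<dots> \<le> 2 / d"
        using False d(1) by (simp add: field_simps del: of_nat_Suc)
      finally show ?thesis by simp
    qed
    then show "\<exists>B. \<forall>h\<in>range q. \<forall>z\<in>K. cmod (h z) \<le> B" by blast
  qed (auto intro: that)
  have "g x = f x" if x: "x \<in> unit_disk" for x
  proof (rule LIMSEQ_unique [OF g(3) [OF x]])
    have "filterlim (\<lambda>n. 1 / real (Suc n)) (at_right 0) sequentially"
      using LIMSEQ_inverse_real_of_nat
      by (auto simp: filterlim_at inverse_eq_divide simp del: of_nat_Suc)
    then have "filterlim (\<lambda>n. 1 / real (Suc (r n))) (at_right 0) sequentially"
      using filterlim_compose [OF _ filterlim_subseq [OF g(2)]] by fast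
    then have "(\<lambda>n. (x - F (1 / Suc (r n)) x) / of_real (1 / Suc (r n))) \<longlonglongrightarrow> f x"
      by (rule filterlim_compose [OF F_generator [OF x]])
    then show "(\<lambda>n. q (r n) x) \<longlonglongrightarrow> f x"
      by (simp add: q_def)
  qed
  then show ?thesis
    using holomorphic_transform [OF g(1)] by blast
qed

text \<open>A zero of \<open>f\<close> would be fixed by every \<open>F \<tau>\<close>, against the
  convergence to \<open>1\<close>. To see this, \<tau> is cut into \<open>Suc n\<close> equal steps
  \<open>h\<close>: the Lipschitz bound makes every increment at most a constant times the first
  one, and the sum is at most a constant times the difference quotient at \<open>h\<close>, which
  tends to \<open>cmod (f z) = 0\<close>.\<close>

lemma generator_nonzero:
  assumes z: "z \<in> unit_disk"
  shows "f z \<noteq> 0"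
proof
  assume f0: "f z = 0"
  define \<rho> where "\<rho> = (1 + cmod z) / 2"
  have \<rho>: "\<rho> < 1" "cmod z < \<rho>" "\<rho> > 0"
    using z by (auto simp: \<rho>_def add_pos_nonneg)
  have pos: "1 - \<rho>\<^sup>2 > 0"
    using \<rho> by (simp add: abs_square_less_1)
  have fixed: "F \<tau> z = z" if \<tau>: "\<tau> > 0" for \<tau>
  proof -
    have lim: "filterlim (\<lambda>n. \<tau> / real (Suc n)) (at_right 0) sequentially"
      using tendsto_mult_right_zero [OF LIMSEQ_inverse_real_of_nat, of \<tau>] \<tau>
      by (auto simp: filterlim_at inverse_eq_divide simp del: of_nat_Suc)
    have "(\<lambda>n. F (\<tau> / Suc n) z) \<longlonglongrightarrow> z"
      by (rule filterlim_compose [OF F_at_zero [OF z] lim])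
    then have ev: "\<forall>\<^sub>F n in sequentially. F (\<tau> / Suc n) z \<in> ball 0 \<rho>"
      by (rule topological_tendstoD) (use \<rho> in auto)
    have "(\<lambda>n. (z - F (\<tau> / Suc n) z) / of_real (\<tau> / Suc n)) \<longlonglongrightarrow> 0"
      using filterlim_compose [OF F_generator [OF z] lim] f0 by simp
    from tendsto_norm_zero [OF this]
    have l0: "(\<lambda>n. \<tau> / (1 - \<rho>\<^sup>2) * cmod ((z - F (\<tau> / Suc n) z) / of_real (\<tau> / Suc n))) \<longlonglongrightarrow> 0"
      by (rule tendsto_mult_right_zero)
    have le: "cmod (F \<tau> z - z) \<le> \<tau> / (1 - \<rho>\<^sup>2) * cmod ((z - F (\<tau> / Suc n) z) / of_real (\<tau> / Suc n))"
      if "F (\<tau> / Suc n) z \<in> ball 0 \<rho>" for n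
    proof -
      define h where "h = \<tau> / Suc n"
      have h: "h > 0" "\<tau> = Suc n * h" using \<tau> by (auto simp: h_def)
      have "F (real k * h) (F h z) = F (real (Suc k) * h) z" for k
        using F_add [of "real k * h" h z] z h by (simp add: algebra_simps)
      then have "(\<Sum>k<Suc n. F (real k * h) (F h z) - F (real k * h) z)
          = (\<Sum>k<Suc n. F (real (Suc k) * h) z - F (real k * h) z)"
        by (simp only:)
      also have "\<dots> = F (real (Suc n) * h) z - F (real 0 * h) z"
        by (rule sum_lessThan_telescope)
      also have "\<dots> = F \<tau> z - z"
        using F_zero [OF z] by (simp add: h(2) [symmetric] del: of_nat_Suc)
      finally have sum_eq: "(\<Sum>k<Suc n. F (real k * h) (F h z) - F (real k * h) z) = F \<tau> z - z" .
      have term_le: "cmod (F (real k * h) (F h z) - F (real k * h) z) \<le> cmod (F h z - z) / (1 - \<rho>\<^sup>2)" for k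
        using that [folded h_def] h(1) \<rho> z by (intro disk_self_map_Lipschitz holo maps) auto
      have "cmod (F \<tau> z - z) \<le> of_nat (card {..<Suc n}) * (cmod (F h z - z) / (1 - \<rho>\<^sup>2))"
        unfolding sum_eq [symmetric] by (rule sum_norm_bound) (rule term_le)
      also have "\<dots> = real (Suc n) * h / (1 - \<rho>\<^sup>2) * cmod ((z - F h z) / of_real h)"
        using h(1) by (simp add: norm_divide norm_minus_commute [of z])
      also have "\<dots> = \<tau> / (1 - \<rho>\<^sup>2) * cmod ((z - F h z) / of_real h)"
        by (simp only: h(2))
      finally show ?thesis by (simp only: h_def)
    qed
    have "cmod (F \<tau> z - z) \<le> 0"
      by (rule tendsto_lowerbound [OF l0]) (use ev le in \<open>auto elim!: eventually_mono\<close>)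
    then show ?thesis by simp
  qed
  have "((\<lambda>t. F t z) \<longlongrightarrow> z) at_top"
    by (rule tendsto_eventually) (use fixed in \<open>auto simp: eventually_at_top_dense\<close>)
  then have "z = 1"
    using F_tendsto_1 [OF z] tendsto_unique trivial_limit_at_top_linorder by blast
  then show False using z by simp
qed

text \<open>Schwarz-Pick is applied to \<open>z\<close> and the points \<open>x n\<close> of an
  orbit converging to \<open>1\<close>. It yields \<open>A n * d n \<le> B n * d (Suc n)\<close>,
  where \<open>A\<close> and \<open>B\<close> converge to the Poisson kernels at \<open>z\<close>
  and \<open>F s z\<close>.\<close>

lemma Wolff_horodisk:
  assumes z: "z \<in> unit_disk" and s: "s \<ge> 0"
  shows "Re (1 / (1 - z)) \<le> Re (1 / (1 - F s z))"
proof (cases "s = 0")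
  case True then show ?thesis using F_zero z by simp
next
  case False
  define x where "x n = F (real n * s) 0" for n
  have xd: "x n \<in> unit_disk" for n
    unfolding x_def using s by (intro F_in) auto
  have xS: "x (Suc n) = F s (x n)" for n
    using F_add [of s "real n * s" 0] s by (simp add: x_def algebra_simps)
  have "filterlim (\<lambda>n. real n * s) at_top sequentially"
    using False s filterlim_at_top_mult_tendsto_pos [OF tendsto_const _ filterlim_real_sequentially, of s]
    by simp
  then have xlim: "x \<longlonglongrightarrow> 1"
    unfolding x_def by (intro filterlim_compose [OF F_tendsto_1]) auto
  then have xlim': "(\<lambda>n. x (Suc n)) \<longlonglongrightarrow> 1"
    by (rule LIMSEQ_Suc)
  define d where "d n = 1 - (cmod (x n))\<^sup>2" for n
  have dpos: "d n > 0" for n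
    using xd [of n] by (simp add: d_def abs_square_less_1)
  have dlim: "d \<longlonglongrightarrow> 0"
    unfolding d_def by (rule tendsto_eq_intros xlim refl | simp)+
  \<comment> \<open>A positive null sequence cannot be nondecreasing from some index on. At the
    indices found here the factors \<open>d\<close> can be removed from the Schwarz-Pick
    inequality.\<close>
  have freq: "\<exists>n\<ge>N. d (Suc n) \<le> d n" for N
  proof (rule ccontr)
    assume "\<not> (\<exists>n\<ge>N. d (Suc n) \<le> d n)"
    then have inc: "d n \<le> d (Suc n)" if "n \<ge> N" for n
      using that by (meson le_cases)
    have "d N \<le> d n" if "n \<ge> N" for n
      using that by (induction rule: dec_induct) (auto intro: order_trans inc)
    then have "d N \<le> 0"
      using dlim by (intro LIMSEQ_le_const) auto
    then show False using dpos [of N] by simp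
  qed
  define A where "A n = (1 - (cmod z)\<^sup>2) / (cmod (1 - cnj (x n) * z))\<^sup>2" for n
  define B where "B n = (1 - (cmod (F s z))\<^sup>2) / (cmod (1 - cnj (x (Suc n)) * F s z))\<^sup>2" for n
  have Fz: "F s z \<in> unit_disk" by (rule F_in [OF s z])
  have "A n * d n \<le> B n * d (Suc n)" for n
  proof -
    have "cmod (Moebius_function 0 (F s (x n)) (F s z)) \<le> cmod (Moebius_function 0 (x n) z)"
      by (rule Schwarz_Pick(1) [OF holo [OF s] maps [OF s] z xd])
    then have "(cmod (Moebius_function 0 (F s (x n)) (F s z)))\<^sup>2 \<le> (cmod (Moebius_function 0 (x n) z))\<^sup>2"
      by (intro power_mono) auto
    then have "1 - (cmod (Moebius_function 0 (x n) z))\<^sup>2 \<le> 1 - (cmod (Moebius_function 0 (x (Suc n)) (F s z)))\<^sup>2"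
      by (simp add: xS)
    moreover have "1 - (cmod (Moebius_function 0 (x n) z))\<^sup>2 = A n * d n"
      using one_minus_cmod_Moebius_function [of "x n" z] xd [of n] z
      by (simp add: A_def d_def mult.commute)
    moreover have "1 - (cmod (Moebius_function 0 (x (Suc n)) (F s z)))\<^sup>2 = B n * d (Suc n)"
      using one_minus_cmod_Moebius_function [of "x (Suc n)" "F s z"] xd [of "Suc n"] Fz
      by (simp add: B_def d_def mult.commute)
    ultimately show ?thesis by simp
  qed
  moreover have "B n \<ge> 0" for n
    using Fz by (auto simp: B_def abs_square_le_1)
  ultimately have AB: "A n \<le> B n" if "d (Suc n) \<le> d n" for n
    using that dpos [of n] by (meson mult_left_mono mult_right_le_imp_le order_trans)
  have "A \<longlonglongrightarrow> (1 - (cmod z)\<^sup>2) / (cmod (1 - cnj 1 * z))\<^sup>2"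
    unfolding A_def using z by (intro tendsto_intros xlim) auto
  moreover have "B \<longlonglongrightarrow> (1 - (cmod (F s z))\<^sup>2) / (cmod (1 - cnj 1 * F s z))\<^sup>2"
    unfolding B_def using Fz by (intro tendsto_intros xlim') auto
  ultimately have "(\<lambda>n. A n - B n) \<longlonglongrightarrow> (1 - (cmod z)\<^sup>2) / (cmod (1 - z))\<^sup>2 - (1 - (cmod (F s z))\<^sup>2) / (cmod (1 - F s z))\<^sup>2"
    by (simp add: tendsto_diff)
  also have "(1 - (cmod z)\<^sup>2) / (cmod (1 - z))\<^sup>2 - (1 - (cmod (F s z))\<^sup>2) / (cmod (1 - F s z))\<^sup>2
     = 2 * (Re (1 / (1 - z)) - Re (1 / (1 - F s z)))"
    using z Fz by (subst (1 2) horodisk_Re_eq) auto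
  finally have lim: "(\<lambda>n. A n - B n) \<longlonglongrightarrow> 2 * (Re (1 / (1 - z)) - Re (1 / (1 - F s z)))" .
  show ?thesis
  proof (rule ccontr)
    assume "\<not> ?thesis"
    then have "\<forall>\<^sub>F n in sequentially. 0 < A n - B n"
      by (intro order_tendstoD(1) [OF lim]) simp
    then obtain N where "\<And>n. n \<ge> N \<Longrightarrow> 0 < A n - B n"
      by (auto simp: eventually_sequentially)
    then show False
      using freq [of N] AB by force
  qed
qed

text \<open>The infinitesimal form of \<open>Wolff_horodisk\<close>: the right derivative of
  \<open>Re (1 / (1 - F s z))\<close> at \<open>s = 0\<close> is nonnegative.\<close>

lemma Re_generator_nonpos:
  assumes z: "z \<in> unit_disk"
  shows "Re (f z / (1 - z)\<^sup>2) \<le> 0"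
proof -
  have nz: "1 - z \<noteq> 0" using z by auto
  have "((\<lambda>z. 1 / (1 - z)) has_field_derivative 1 / (1 - z)\<^sup>2) (at z)"
    by (rule derivative_eq_intros refl nz | simp add: nz power2_eq_square)+
  from chain_rule_at_zero [OF z this]
  have "((\<lambda>s. Re ((1 / (1 - F s z) - 1 / (1 - z)) / of_real s)) \<longlongrightarrow> Re (- (1 / (1 - z)\<^sup>2) * f z)) (at_right 0)"
    by (rule tendsto_Re)
  moreover have "\<forall>\<^sub>F s in at_right 0. 0 \<le> Re ((1 / (1 - F s z) - 1 / (1 - z)) / of_real s)"
    using Wolff_horodisk [OF z] by (auto simp: eventually_at_right_field intro!: exI [of _ 1])
  ultimately have "0 \<le> Re (- (1 / (1 - z)\<^sup>2) * f z)"
    by (intro tendsto_lowerbound) auto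
  then show ?thesis by simp
qed

section \<open>Abel function\<close>

text \<open>A predicate, since \<open>h\<close> is determined only up to an additive constant; lying
  in a half-plane is insensitive to that constant.\<close>

definition Abel_function :: "(complex \<Rightarrow> complex) \<Rightarrow> bool" where
  "Abel_function h \<longleftrightarrow> (\<forall>z\<in>unit_disk. (h has_field_derivative - 1 / f z) (at z))"

lemma Abel_function_exists: obtains h where "Abel_function h"
proof -
  have "(\<lambda>z. - 1 / f z) holomorphic_on unit_disk"
    by (intro holomorphic_intros generator_holomorphic generator_nonzero)
  then obtain h where "\<And>x. x \<in> unit_disk \<Longrightarrow> (h has_field_derivative - 1 / f x) (at x within unit_disk)"
    using holomorphic_convex_primitive' [OF convex_ball open_ball] by blast
  then have "Abel_function h"
    by (auto simp: Abel_function_def at_within_open [OF _ open_ball] simp del: mem_ball)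
  then show thesis by (rule that)
qed

text \<open>By the semigroup law and \<open>chain_rule_at_zero\<close> at the point
  \<open>F t z\<close>, the function \<open>h (F t z) - t\<close> has right derivative
  \<open>0\<close> at every time.\<close>

lemma Abel_equation:
  assumes h: "Abel_function h" and z: "z \<in> unit_disk" and t: "t \<ge> 0"
  shows "h (F t z) = h z + of_real t"
proof -
  have der: "w \<in> unit_disk \<Longrightarrow> (h has_field_derivative - 1 / f w) (at w)" for w
    using h by (simp add: Abel_function_def)
  have conth: "continuous_on unit_disk h"
    by (meson der continuous_at_imp_continuous_on DERIV_isCont)
  define \<phi> where "\<phi> t = h (F t z) - of_real t" for t
  have "\<phi> t = \<phi> 0"
  proof (rule right_derivative_zero_constant [OF _ _ t])
    show "continuous_on {0..} \<phi>"
      unfolding \<phi>_def using F_in [OF _ z]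
      by (intro continuous_intros continuous_on_compose2 [OF conth trajectory_continuous [OF z]]) auto
    fix t :: real assume t: "t \<ge> 0"
    have w: "F t z \<in> unit_disk" by (rule F_in [OF t z])
    have "((\<lambda>s. (h (F s (F t z)) - h (F t z)) / of_real s - 1) \<longlongrightarrow> - (- 1 / f (F t z)) * f (F t z) - 1) (at_right 0)"
      by (intro tendsto_diff tendsto_const chain_rule_at_zero w der)
    then have lim: "((\<lambda>s. (h (F s (F t z)) - h (F t z)) / of_real s - 1) \<longlongrightarrow> 0) (at_right 0)"
      using generator_nonzero [OF w] by simp
    show "((\<lambda>s. (\<phi> (t + s) - \<phi> t) /\<^sub>R s) \<longlongrightarrow> 0) (at_right 0)"
    proof (rule Lim_transform_eventually [OF lim])
      show "\<forall>\<^sub>F s in at_right 0. (h (F s (F t z)) - h (F t z)) / of_real s - 1 = (\<phi> (t + s) - \<phi> t) /\<^sub>R s"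
      proof (rule eventually_at_rightI [of 0 1])
        fix s :: real assume "s \<in> {0<..<1}"
        then show "(h (F s (F t z)) - h (F t z)) / of_real s - 1 = (\<phi> (t + s) - \<phi> t) /\<^sub>R s"
          using F_add [of s t z] t z by (simp add: \<phi>_def scaleR_conv_of_real add.commute field_simps)
      qed simp
    qed
  qed
  then show ?thesis
    using F_zero [OF z] by (simp add: \<phi>_def algebra_simps)
qed

text \<open>In the coordinate \<open>u = 1 / (1 - z)\<close>, which maps the disk onto a half-plane, the derivative
  of the Abel function is \<open>- (1 - z)\<^sup>2 / f z\<close> and has nonnegative real part.\<close>

lemma Abel_function_inj:
  assumes h: "Abel_function h"
  shows "inj_on h unit_disk"
proof -
  let ?H = "{u. 1 / 2 < Re u}" and ?m = "\<lambda>u::complex. 1 - 1 / u"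
  have nz: "u \<noteq> 0" if "u \<in> ?H" for u using that by auto
  have m: "?m u \<in> unit_disk" if "u \<in> ?H" for u
    using half_plane_to_disk that by blast
  have "inj_on (\<lambda>u. h (?m u)) ?H"
  proof (rule inj_on_if_Re_deriv_nonneg)
    show "convex ?H" by (rule convex_halfspace_Re_gt)
    show "open ?H" by (rule open_halfspace_Re_gt)
    fix u assume u: "u \<in> ?H"
    have "(h has_field_derivative - 1 / f (?m u)) (at (?m u))"
      using h m [OF u] by (simp add: Abel_function_def)
    moreover have "(?m has_field_derivative 1 / u\<^sup>2) (at u)"
      using nz [OF u] by (auto intro!: derivative_eq_intros simp: power2_eq_square)
    ultimately show "((\<lambda>u. h (?m u)) has_field_derivative (- 1 / f (?m u)) * (1 / u\<^sup>2)) (at u)"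
      by (rule DERIV_chain2)
    have fn: "f (?m u) \<noteq> 0" by (rule generator_nonzero [OF m [OF u]])
    then show "(- 1 / f (?m u)) * (1 / u\<^sup>2) \<noteq> 0"
      using nz [OF u] by simp
    \<comment> \<open>The derivative in the coordinate \<open>u\<close> is \<open>- 1 / p\<close>,
      and inversion preserves the sign of the real part.\<close>
    define p where "p = f (?m u) / (1 - ?m u)\<^sup>2"
    have "Re p \<le> 0" unfolding p_def by (rule Re_generator_nonpos [OF m [OF u]])
    moreover have "(- 1 / f (?m u)) * (1 / u\<^sup>2) = - (1 / p)"
      using nz [OF u] fn by (simp add: p_def power_divide)
    moreover have "Re (1 / p) = Re p / (cmod p)\<^sup>2"
      unfolding Re_divide' by simp
    ultimately show "0 \<le> Re ((- 1 / f (?m u)) * (1 / u\<^sup>2))"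
      by (simp add: divide_nonpos_nonneg)
  qed
  then have inj: "\<And>u v. u \<in> ?H \<Longrightarrow> v \<in> ?H \<Longrightarrow> h (?m u) = h (?m v) \<Longrightarrow> u = v"
    by (auto dest: inj_onD)
  show ?thesis
  proof (rule inj_onI)
    fix z w assume zw: "z \<in> unit_disk" "w \<in> unit_disk" "h z = h w"
    have K: "1 / (1 - z) \<in> ?H" "1 / (1 - w) \<in> ?H"
      using disk_Re_gt_half zw(1,2) by blast+
    have "1 / (1 - z) = 1 / (1 - w)"
      by (rule inj [OF K]) (simp add: zw(3))
    then show "z = w" using zw by auto
  qed
qed

end

section \<open>Asymptotics at the Denjoy--Wolff point\<close>

lemma cmod_powr_of_real: "cmod (z powr of_real \<beta>) = cmod z powr \<beta>"
  by (simp add: norm_powr_real_powr')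

text \<open>The error is integrated along the segment from \<open>z\<close> to a point \<open>b < 1\<close> of the real axis,
  where the distance to \<open>1\<close> is comparable to its linear interpolation \<open>\<bar>1 - z\<bar> + s (\<bar>1 - b\<bar> - \<bar>1 - z\<bar>)\<close>
  even if \<open>z\<close> approaches \<open>1\<close> tangentially.\<close>

lemma segment_bound:
  assumes \<alpha>: "\<alpha> > 0" and b: "0 < r" "r < 1" and z: "z \<in> unit_disk" "3 * cmod (1 - z) < r"
    and \<epsilon>: "\<epsilon> \<ge> 0"
    and der: "\<And>x. x \<in> unit_disk \<Longrightarrow> (E has_field_derivative E' x) (at x)"
    and bnd: "\<And>x. x \<in> unit_disk \<Longrightarrow> cmod (1 - x) \<le> r \<Longrightarrow> cmod (E' x) \<le> \<epsilon> * cmod (1 - x) powr (- 1 - \<alpha>)"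
  shows "cmod (E (of_real (1 - r)) - E z) \<le> \<epsilon> * 2 powr (2 + \<alpha>) / \<alpha> * cmod (1 - z) powr (- \<alpha>)"
proof -
  define w where "w = cmod (1 - z)"
  have w: "w > 0" "3 * w < r" using z by (auto simp: w_def)
  define \<gamma> where "\<gamma> s = z + of_real s * (of_real (1 - r) - z)" for s :: real
  define m where "m s = w + s * (r - w)" for s
  \<comment> \<open>One factor \<open>2\<close> comes from the speed of the segment, at most
    \<open>2 * (r - w)\<close> because \<open>3 * w < r\<close>; the factor
    \<open>2 powr (1 + \<alpha>)\<close> is the price of replacing the distance to \<open>1\<close>
    by \<open>m s / 2\<close>.\<close>
  define K where "K = \<epsilon> * 2 powr (2 + \<alpha>)"
  have Rez: "Re (1 - z) > 0"
    using z complex_Re_le_cmod [of z] by simp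
  have one_minus: "1 - \<gamma> s = of_real (1 - s) * (1 - z) + of_real (s * r)" for s
    by (simp add: \<gamma>_def algebra_simps)
  have \<gamma>d: "\<gamma> s \<in> unit_disk" if "0 \<le> s" "s \<le> 1" for s
  proof -
    have "\<gamma> s = (1 - s) *\<^sub>R z + s *\<^sub>R of_real (1 - r)"
      by (simp add: \<gamma>_def scaleR_conv_of_real algebra_simps)
    moreover have "complex_of_real (1 - r) \<in> unit_disk"
      using b by (simp del: of_real_diff)
    ultimately show ?thesis
      using convexD [OF convex_ball z(1), of _ "1 - s" s] that by simp
  qed
  have m_pos: "m s > 0" if "0 \<le> s" "s \<le> 1" for s
    using w that by (simp add: m_def add_pos_nonneg)
  have le_r: "cmod (1 - \<gamma> s) \<le> r" if "0 \<le> s" "s \<le> 1" for s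
  proof -
    have "cmod (1 - \<gamma> s) \<le> (1 - s) * w + s * r"
      unfolding one_minus using that b
      by (intro order_trans [OF norm_triangle_ineq]) (simp add: norm_mult w_def del: of_real_mult of_real_diff)
    also have "\<dots> \<le> (1 - s) * r + s * r"
      using w that by (intro add_mono mult_left_mono) auto
    finally show ?thesis by (simp add: algebra_simps)
  qed
  \<comment> \<open>The vectors \<open>(1 - s) * (1 - z)\<close> and \<open>s * r\<close> enclose an
    acute angle because \<open>Re (1 - z) > 0\<close>, so the squared length of their sum is at
    least the sum of their squared lengths.\<close>
  have ge_m: "m s / 2 \<le> cmod (1 - \<gamma> s)" if s: "0 \<le> s" "s \<le> 1" for s
  proof -
    let ?p = "(1 - s) * w" and ?q = "s * r"
    have pq: "?p \<ge> 0" "?q \<ge> 0" using s w b by auto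
    have "(cmod (1 - \<gamma> s))\<^sup>2 = ((1 - s) * Re (1 - z) + ?q)\<^sup>2 + ((1 - s) * Im (1 - z))\<^sup>2"
      unfolding one_minus cmod_power2 by simp
    also have "\<dots> = (1 - s)\<^sup>2 * ((Re (1 - z))\<^sup>2 + (Im (1 - z))\<^sup>2) + 2 * ?q * ((1 - s) * Re (1 - z)) + ?q\<^sup>2"
      by (simp add: power2_eq_square algebra_simps)
    also have "(Re (1 - z))\<^sup>2 + (Im (1 - z))\<^sup>2 = w\<^sup>2"
      by (simp only: w_def cmod_power2)
    also have "(1 - s)\<^sup>2 * w\<^sup>2 + 2 * ?q * ((1 - s) * Re (1 - z)) + ?q\<^sup>2 \<ge> ?p\<^sup>2 + ?q\<^sup>2"
      using pq s Rez by (simp add: power_mult_distrib)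
    finally have "?p\<^sup>2 + ?q\<^sup>2 \<le> (cmod (1 - \<gamma> s))\<^sup>2" .
    moreover have "((?p + ?q) / 2)\<^sup>2 \<le> ?p\<^sup>2 + ?q\<^sup>2"
    proof -
      have "?p\<^sup>2 + ?q\<^sup>2 - ((?p + ?q) / 2)\<^sup>2 = ((?p - ?q)\<^sup>2 + 2 * ?p\<^sup>2 + 2 * ?q\<^sup>2) / 4"
        by (simp add: power2_eq_square field_simps)
      then show ?thesis by (smt (verit) divide_nonneg_nonneg zero_le_power2)
    qed
    ultimately have "((?p + ?q) / 2)\<^sup>2 \<le> (cmod (1 - \<gamma> s))\<^sup>2" by linarith
    then have "(?p + ?q) / 2 \<le> cmod (1 - \<gamma> s)"
      by (rule power2_le_imp_le) simp
    then show ?thesis by (simp add: m_def algebra_simps)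
  qed
  have d\<gamma>: "(\<gamma> has_vector_derivative (of_real (1 - r) - z)) (at s)" for s
    unfolding \<gamma>_def has_vector_derivative_def
    by (auto intro!: derivative_eq_intros simp: scaleR_conv_of_real)
  have dE: "((\<lambda>s. E (\<gamma> s)) has_vector_derivative (of_real (1 - r) - z) * E' (\<gamma> s)) (at s)"
    if "0 \<le> s" "s \<le> 1" for s
    using field_vector_diff_chain_at [OF d\<gamma> der [OF \<gamma>d [OF that]]] by (simp add: o_def)
  \<comment> \<open>An explicit primitive of the majorant of the speed of
    \<open>E (\<gamma> s)\<close>; comparing increments replaces an integral.\<close>
  have d\<phi>: "((\<lambda>s. - (K / \<alpha>) * m s powr (- \<alpha>)) has_vector_derivative K * m s powr (- 1 - \<alpha>) * (r - w)) (at s)"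
    if "0 \<le> s" "s \<le> 1" for s
  proof -
    have "(m has_field_derivative (r - w)) (at s)"
      unfolding m_def by (auto intro!: derivative_eq_intros)
    then have "((\<lambda>s. m s powr (- \<alpha>)) has_field_derivative ((- \<alpha>) * m s powr (- \<alpha> - of_nat 1) * (r - w))) (at s)"
      by (rule DERIV_fun_powr) (rule m_pos [OF that])
    then have "((\<lambda>s. - (K / \<alpha>) * m s powr (- \<alpha>)) has_field_derivative
        (- (K / \<alpha>) * ((- \<alpha>) * m s powr (- \<alpha> - of_nat 1) * (r - w)))) (at s)"
      by (rule DERIV_cmult)
    moreover have "- (K / \<alpha>) * ((- \<alpha>) * m s powr (- \<alpha> - of_nat 1) * (r - w)) = K * m s powr (- 1 - \<alpha>) * (r - w)"
    proof -
      have "- \<alpha> - of_nat 1 = - 1 - \<alpha>" by simp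
      then show ?thesis using \<alpha> by (simp only:) simp
    qed
    ultimately show ?thesis
      by (simp add: has_real_derivative_iff_has_vector_derivative)
  qed
  have "cmod (E (\<gamma> 1) - E (\<gamma> 0)) \<le> - (K / \<alpha>) * m 1 powr (- \<alpha>) - (- (K / \<alpha>) * m 0 powr (- \<alpha>))"
  proof (rule differentiable_bound_general [OF zero_less_one])
    show "continuous_on {0..1} (\<lambda>s. E (\<gamma> s))"
      using dE by (intro continuous_at_imp_continuous_on ballI)
        (auto intro: has_vector_derivative_continuous)
    show "continuous_on {0..1} (\<lambda>s. - (K / \<alpha>) * m s powr (- \<alpha>))"
      using d\<phi> by (intro continuous_at_imp_continuous_on ballI has_vector_derivative_continuous) auto
    fix s :: real assume s: "0 < s" "s < 1"
    show "((\<lambda>s. E (\<gamma> s)) has_vector_derivative (of_real (1 - r) - z) * E' (\<gamma> s)) (at s)"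
      using dE s by simp
    show "((\<lambda>s. - (K / \<alpha>) * m s powr (- \<alpha>)) has_vector_derivative K * m s powr (- 1 - \<alpha>) * (r - w)) (at s)"
      using d\<phi> s by simp
    have "cmod (of_real (1 - r) - z) = cmod ((1 - z) - of_real r)"
      by (simp add: algebra_simps)
    also have "\<dots> \<le> w + r"
      using norm_triangle_ineq4 [of "1 - z" "of_real r"] b by (simp add: w_def)
    also have "\<dots> \<le> 2 * (r - w)"
      using w by simp
    finally have A: "cmod (of_real (1 - r) - z) \<le> 2 * (r - w)" .
    have "cmod (E' (\<gamma> s)) \<le> \<epsilon> * cmod (1 - \<gamma> s) powr (- 1 - \<alpha>)"
      using s by (intro bnd \<gamma>d le_r) auto
    also have "\<dots> \<le> \<epsilon> * (m s / 2) powr (- 1 - \<alpha>)"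
      using s m_pos [of s] ge_m [of s] \<epsilon> \<alpha> by (intro mult_left_mono powr_mono2') auto
    also have "(m s / 2) powr (- 1 - \<alpha>) = m s powr (- 1 - \<alpha>) * 2 powr (1 + \<alpha>)"
      using m_pos [of s] s powr_minus_divide [of 2 "1 + \<alpha>"] by (simp add: powr_divide)
    finally have B: "cmod (E' (\<gamma> s)) \<le> \<epsilon> * (m s powr (- 1 - \<alpha>) * 2 powr (1 + \<alpha>))" .
    have "cmod ((of_real (1 - r) - z) * E' (\<gamma> s)) \<le> (2 * (r - w)) * (\<epsilon> * (m s powr (- 1 - \<alpha>) * 2 powr (1 + \<alpha>)))"
      unfolding norm_mult using A B w by (intro mult_mono) auto
    also have "\<dots> = K * m s powr (- 1 - \<alpha>) * (r - w)"
    proof -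
      have "(2::real) powr (2 + \<alpha>) = 2 powr (1 + (1 + \<alpha>))" by simp
      also have "\<dots> = 2 * 2 powr (1 + \<alpha>)" by (subst powr_add) simp
      finally show ?thesis by (simp only: K_def mult_ac)
    qed
    finally show "cmod ((of_real (1 - r) - z) * E' (\<gamma> s)) \<le> K * m s powr (- 1 - \<alpha>) * (r - w)" .
  qed
  also have "\<dots> \<le> K / \<alpha> * w powr (- \<alpha>)"
    using \<alpha> \<epsilon> by (simp add: m_def K_def)
  finally show ?thesis
    by (simp add: \<gamma>_def K_def w_def norm_minus_commute)
qed

text \<open>The error \<open>E\<close> has a derivative of size
  \<open>\<epsilon> * cmod (1 - z) powr (- 1 - \<alpha>)\<close> near \<open>1\<close>, so
  \<open>segment_bound\<close> controls it up to its value at the fixed point \<open>1 - r\<close>.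
  Multiplication by \<open>cmod (1 - z) powr \<alpha>\<close> makes this value negligible.\<close>

lemma tendsto_times_powr_of_deriv:
  fixes h h' :: "complex \<Rightarrow> complex"
  assumes \<alpha>: "\<alpha> > 0"
    and der: "\<And>z. z \<in> unit_disk \<Longrightarrow> (h has_field_derivative h' z) (at z)"
    and lim: "((\<lambda>z. h' z * (1 - z) powr of_real (1 + \<alpha>)) \<longlongrightarrow> of_real \<alpha> * c) (at 1 within unit_disk)"
  shows "((\<lambda>z. h z * (1 - z) powr of_real \<alpha>) \<longlongrightarrow> c) (at 1 within unit_disk)"
proof (rule tendstoI)
  fix \<eta> :: real assume "\<eta> > 0"
  define E where "E z = h z - c * (1 - z) powr of_real (- \<alpha>)" for z
  define E' where "E' z = h' z - of_real \<alpha> * c * (1 - z) powr of_real (- 1 - \<alpha>)" for z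
  have nz: "1 - z \<noteq> 0" "1 - z \<notin> \<real>\<^sub>\<le>\<^sub>0" if "z \<in> unit_disk" for z
  proof -
    have "Re (1 - z) > 0" using that complex_Re_le_cmod [of z] by simp
    then show "1 - z \<noteq> 0" "1 - z \<notin> \<real>\<^sub>\<le>\<^sub>0" by (auto simp: complex_nonpos_Reals_iff)
  qed
  have dE: "(E has_field_derivative E' z) (at z)" if z: "z \<in> unit_disk" for z
  proof -
    have e: "- complex_of_real \<alpha> - 1 = - 1 - of_real \<alpha>" by simp
    have "((\<lambda>z. (1 - z) powr of_real (- \<alpha>)) has_field_derivative
        (of_real (- \<alpha>) * (1 - z) powr (of_real (- \<alpha>) - 1)) * (0 - 1)) (at z)"
      using nz(2) [OF z] by (auto intro!: derivative_eq_intros)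
    then show ?thesis
      unfolding E_def E'_def
      by (rule DERIV_cong [OF DERIV_diff [OF der [OF z] DERIV_cmult]]) (simp add: e)
  qed
  \<comment> \<open>Chosen so that the constant of \<open>segment_bound\<close> becomes
    \<open>\<eta> / 2\<close>.\<close>
  define \<epsilon> where "\<epsilon> = \<eta> * \<alpha> / (2 * 2 powr (2 + \<alpha>))"
  have "\<epsilon> > 0" using \<open>\<eta> > 0\<close> \<alpha> by (simp add: \<epsilon>_def)
  obtain \<delta> where \<delta>: "\<delta> > 0" "\<And>z. z \<in> unit_disk \<Longrightarrow> dist z 1 < \<delta> \<Longrightarrow>
      dist (h' z * (1 - z) powr of_real (1 + \<alpha>)) (of_real \<alpha> * c) < \<epsilon>"
    using tendstoD [OF lim \<open>\<epsilon> > 0\<close>] nz(1) by (auto simp: eventually_at)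
  have E'_bound: "cmod (E' z) \<le> \<epsilon> * cmod (1 - z) powr (- 1 - \<alpha>)"
    if z: "z \<in> unit_disk" and "cmod (1 - z) < \<delta>" for z
  proof -
    have inv: "(1 - z) powr of_real (1 + \<alpha>) * (1 - z) powr of_real (- 1 - \<alpha>) = 1"
      using nz(1) [OF z] by (simp flip: powr_add)
    have "E' z = (h' z * (1 - z) powr of_real (1 + \<alpha>) - of_real \<alpha> * c) * (1 - z) powr of_real (- 1 - \<alpha>)"
      unfolding E'_def left_diff_distrib mult.assoc [of "h' z"] inv by simp
    moreover have "cmod (h' z * (1 - z) powr of_real (1 + \<alpha>) - of_real \<alpha> * c) \<le> \<epsilon>"
      using \<delta>(2) [OF z] that(2) by (simp add: dist_norm norm_minus_commute less_imp_le)
    ultimately show ?thesis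
      using cmod_powr_of_real by (simp only: norm_mult) (intro mult_right_mono, auto)
  qed
  define r where "r = min (\<delta> / 2) (1 / 2)"
  have r: "0 < r" "r < 1" "r < \<delta>" using \<open>\<delta> > 0\<close> by (auto simp: r_def)
  let ?B = "cmod (E (of_real (1 - r)))"
  have bound: "dist (h z * (1 - z) powr of_real \<alpha>) c \<le> ?B * cmod (1 - z) powr \<alpha> + \<eta> / 2"
    if z: "z \<in> unit_disk" "3 * cmod (1 - z) < r" for z
  proof -
    have inv: "(1 - z) powr of_real (- \<alpha>) * (1 - z) powr of_real \<alpha> = 1"
      using nz(1) [OF z(1)] by (simp flip: powr_add)
    have "h z * (1 - z) powr of_real \<alpha> - c = E z * (1 - z) powr of_real \<alpha>"
      unfolding E_def left_diff_distrib mult.assoc inv by simp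
    then have "dist (h z * (1 - z) powr of_real \<alpha>) c = cmod (E z) * cmod (1 - z) powr \<alpha>"
      by (simp only: dist_norm norm_mult cmod_powr_of_real)
    also have "\<dots> \<le> (?B + \<epsilon> * 2 powr (2 + \<alpha>) / \<alpha> * cmod (1 - z) powr (- \<alpha>)) * cmod (1 - z) powr \<alpha>"
    proof (intro mult_right_mono)
      have "cmod (E (of_real (1 - r)) - E z) \<le> \<epsilon> * 2 powr (2 + \<alpha>) / \<alpha> * cmod (1 - z) powr (- \<alpha>)"
        using r \<open>\<epsilon> > 0\<close> by (intro segment_bound [OF \<alpha> r(1,2) z _ dE E'_bound]) auto
      then show "cmod (E z) \<le> ?B + \<epsilon> * 2 powr (2 + \<alpha>) / \<alpha> * cmod (1 - z) powr (- \<alpha>)"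
        using norm_triangle_sub [of "E z" "E (of_real (1 - r))"] by (simp add: norm_minus_commute)
    qed simp
    also have "\<dots> = ?B * cmod (1 - z) powr \<alpha> + \<epsilon> * 2 powr (2 + \<alpha>) / \<alpha>"
      using nz(1) [OF z(1)] by (simp add: distrib_right mult.assoc flip: powr_add)
    also have "\<epsilon> * 2 powr (2 + \<alpha>) / \<alpha> = \<eta> / 2"
      using \<alpha> by (simp add: \<epsilon>_def)
    finally show ?thesis .
  qed
  have "((\<lambda>z. ?B * cmod (1 - z) powr \<alpha> + \<eta> / 2) \<longlongrightarrow> ?B * 0 + \<eta> / 2) (at 1 within unit_disk)"
  proof (intro tendsto_intros)
    have "((\<lambda>z. cmod (1 - z)) \<longlongrightarrow> 0) (at 1 within unit_disk)"
      by (rule tendsto_eq_intros refl | simp)+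
    then show "((\<lambda>z. cmod (1 - z) powr \<alpha>) \<longlongrightarrow> 0) (at 1 within unit_disk)"
      by (rule tendsto_zero_powrI) (use \<alpha> in auto)
  qed
  then have ev1: "\<forall>\<^sub>F z in at 1 within unit_disk. ?B * cmod (1 - z) powr \<alpha> + \<eta> / 2 < \<eta>"
    by (rule order_tendstoD(2)) (use \<open>\<eta> > 0\<close> in simp)
  have ev2: "\<forall>\<^sub>F z in at 1 within unit_disk. z \<in> unit_disk \<and> 3 * cmod (1 - z) < r"
    unfolding eventually_at using r
    by (intro exI [of _ "r / 3"]) (auto simp: dist_norm norm_minus_commute)
  show "\<forall>\<^sub>F z in at 1 within unit_disk. dist (h z * (1 - z) powr of_real \<alpha>) c < \<eta>"
    using ev1 ev2 by eventually_elim (use bound in \<open>auto intro: le_less_trans\<close>)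
qed

section \<open>Conjugation with parabolic groups\<close>

text \<open>Translation by \<open>- \<i> * \<sigma> * t\<close> in the coordinate
  \<open>1 / (1 - \<zeta>)\<close>. The sign is that of \<open>- \<i> * \<sigma> * h\<close>, the
  function that moves in this way when \<open>h\<close> grows by \<open>t\<close>.\<close>

definition half_plane_shift :: "real \<Rightarrow> real \<Rightarrow> complex \<Rightarrow> complex" where
  "half_plane_shift \<sigma> t \<zeta> = 1 - 1 / (1 / (1 - \<zeta>) - \<i> * of_real (\<sigma> * t))"

lemma half_plane_shift_in_disk:
  assumes "\<zeta> \<in> unit_disk"
  shows "half_plane_shift \<sigma> t \<zeta> \<in> unit_disk"
  unfolding half_plane_shift_def
  using disk_Re_gt_half [OF assms] by (intro half_plane_to_disk) simp

lemma half_plane_shift_coordinate: "1 / (1 - half_plane_shift \<sigma> t \<zeta>) = 1 / (1 - \<zeta>) - \<i> * of_real (\<sigma> * t)"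
  by (simp add: half_plane_shift_def)

lemma half_plane_shift_add:
  "half_plane_shift \<sigma> (t + s) \<zeta> = half_plane_shift \<sigma> t (half_plane_shift \<sigma> s \<zeta>)"
  unfolding half_plane_shift_def [of \<sigma> t "half_plane_shift \<sigma> s \<zeta>"] half_plane_shift_coordinate
  by (simp add: half_plane_shift_def algebra_simps)

lemma half_plane_shift_zero: "\<zeta> \<in> unit_disk \<Longrightarrow> half_plane_shift \<sigma> 0 \<zeta> = \<zeta>"
  by (simp add: half_plane_shift_def)

lemma half_plane_coordinate_nonzero:
  assumes "\<zeta> \<in> unit_disk"
  shows "1 / (1 - \<zeta>) - \<i> * of_real (\<sigma> * t) \<noteq> 0"
proof
  assume "1 / (1 - \<zeta>) - \<i> * of_real (\<sigma> * t) = 0"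
  then have "Re (1 / (1 - \<zeta>) - \<i> * of_real (\<sigma> * t)) = 0" by (simp only: zero_complex.simps)
  then show False using disk_Re_gt_half [OF assms] by simp
qed

lemma half_plane_shift_automorphism: "disk_automorphism (half_plane_shift \<sigma> t)"
  unfolding disk_automorphism_def
proof
  show "half_plane_shift \<sigma> t holomorphic_on unit_disk"
    unfolding half_plane_shift_def [abs_def]
    using half_plane_coordinate_nonzero by (intro holomorphic_intros) auto
  show "bij_betw (half_plane_shift \<sigma> t) unit_disk unit_disk"
  proof (rule bij_betw_byWitness [of _ "half_plane_shift \<sigma> (- t)"])
    show "\<forall>\<zeta>\<in>unit_disk. half_plane_shift \<sigma> (- t) (half_plane_shift \<sigma> t \<zeta>) = \<zeta>"
      using half_plane_shift_add [of \<sigma> "- t" t, symmetric] half_plane_shift_zero by simp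
    show "\<forall>\<zeta>\<in>unit_disk. half_plane_shift \<sigma> t (half_plane_shift \<sigma> (- t) \<zeta>) = \<zeta>"
      using half_plane_shift_add [of \<sigma> t "- t", symmetric] half_plane_shift_zero by simp
  qed (use half_plane_shift_in_disk in blast)+
qed

lemma half_plane_shift_parabolic:
  assumes "\<sigma> \<noteq> 0" "t \<noteq> 0"
  shows "parabolic_automorphism (half_plane_shift \<sigma> t)"
proof -
  \<comment> \<open>At \<open>\<zeta> = 1\<close> the convention \<open>1 / 0 = 0\<close> makes
    \<open>half_plane_shift\<close> discontinuous; clearing the inner fraction gives the extension
    that is continuous and fixes \<open>1\<close>.\<close>
  define e where "e \<zeta> = 1 - (1 - \<zeta>) / (1 - \<i> * of_real (\<sigma> * t) * (1 - \<zeta>))" for \<zeta> :: complex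
  have nz: "1 - \<i> * of_real (\<sigma> * t) * (1 - \<zeta>) \<noteq> 0" if "\<zeta> \<in> cball 0 1" for \<zeta>
  proof
    assume eq: "1 - \<i> * of_real (\<sigma> * t) * (1 - \<zeta>) = 0"
    have "Im (1 - \<i> * of_real (\<sigma> * t) * (1 - \<zeta>)) = - (\<sigma> * t) * (1 - Re \<zeta>)"
      by simp
    then have "- (\<sigma> * t) * (1 - Re \<zeta>) = 0" unfolding eq by simp
    then have "Re \<zeta> = 1" using assms by simp
    moreover have "(Re \<zeta>)\<^sup>2 + (Im \<zeta>)\<^sup>2 \<le> 1"
      using that by (simp add: abs_square_le_1 flip: cmod_power2)
    ultimately have "\<zeta> = 1" by (simp add: complex_eq_iff)
    then show False using eq by simp
  qed
  have "continuous_on (cball 0 1) e"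
    unfolding e_def using nz by (intro continuous_intros) auto
  moreover have "e \<zeta> = half_plane_shift \<sigma> t \<zeta>" if "\<zeta> \<in> unit_disk" for \<zeta>
  proof -
    have z1: "1 - \<zeta> \<noteq> 0" using that by auto
    have "1 / (1 - \<zeta>) - \<i> * of_real (\<sigma> * t) = (1 - \<i> * of_real (\<sigma> * t) * (1 - \<zeta>)) / (1 - \<zeta>)"
      using z1 by (simp add: diff_divide_distrib)
    then show ?thesis
      unfolding e_def half_plane_shift_def by simp
  qed
  moreover have "{\<zeta> \<in> cball 0 1. e \<zeta> = \<zeta>} = {1}"
  proof (intro equalityI subsetI)
    fix \<zeta> assume "\<zeta> \<in> {\<zeta> \<in> cball 0 1. e \<zeta> = \<zeta>}"
    then have \<zeta>: "\<zeta> \<in> cball 0 1" "(1 - \<zeta>) / (1 - \<i> * of_real (\<sigma> * t) * (1 - \<zeta>)) = 1 - \<zeta>"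
      by (auto simp: e_def algebra_simps)
    then have "1 - \<zeta> = (1 - \<zeta>) * (1 - \<i> * of_real (\<sigma> * t) * (1 - \<zeta>))"
      using nz [OF \<zeta>(1)] by (simp only: divide_eq_eq) simp
    then have "\<i> * of_real (\<sigma> * t) * (1 - \<zeta>)\<^sup>2 = 0"
      by (simp add: algebra_simps power2_eq_square)
    then show "\<zeta> \<in> {1}" using assms by simp
  qed (simp add: e_def)
  ultimately show ?thesis
    unfolding parabolic_automorphism_def using half_plane_shift_automorphism
    by (intro conjI exI [of _ e] bexI [of _ 1]) auto
qed

lemma half_plane_shift_parabolic_group:
  assumes "\<sigma> \<noteq> 0"
  shows "parabolic_group (half_plane_shift \<sigma>)"
  unfolding parabolic_group_def
proof (intro conjI allI ballI impI)
  fix \<zeta> :: complex assume \<zeta>: "\<zeta> \<in> unit_disk"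
  have "((\<lambda>t. half_plane_shift \<sigma> t \<zeta>) \<longlongrightarrow> half_plane_shift \<sigma> 0 \<zeta>) (at 0)"
    unfolding half_plane_shift_def using \<zeta> by (intro tendsto_intros) auto
  then show "((\<lambda>t. half_plane_shift \<sigma> t \<zeta>) \<longlongrightarrow> \<zeta>) (at 0)"
    using half_plane_shift_zero [OF \<zeta>] by simp
qed (use assms half_plane_shift_automorphism half_plane_shift_zero half_plane_shift_add
      half_plane_shift_parabolic in auto)

text \<open>The sign \<sigma> is \<open>1\<close> for an upper and \<open>- 1\<close> for a lower
  half-plane, so that one argument treats both.\<close>

definition image_in_half_plane :: "(complex \<Rightarrow> complex) \<Rightarrow> bool" where
  "image_in_half_plane h \<longleftrightarrow> (\<exists>\<sigma> m :: real. \<bar>\<sigma>\<bar> = 1 \<and> (\<forall>z\<in>unit_disk. m < \<sigma> * Im (h z)))"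

context disk_semigroup
begin

text \<open>Rotating and shifting the half-plane onto \<open>Re > 1 / 2\<close>, the range of
  \<open>1 / (1 - z)\<close> on the disk, makes \<open>h\<close> into \<open>\<Phi>\<close>;
  returning to the disk gives the conjugating map.\<close>

lemma outer_conjugate_if_half_plane:
  assumes h: "Abel_function h" and "image_in_half_plane h"
  shows "\<exists>G. parabolic_group G \<and> outer_conjugate F G"
proof -
  obtain \<sigma> m where \<sigma>: "\<bar>\<sigma>\<bar> = 1" and m: "\<And>z. z \<in> unit_disk \<Longrightarrow> m < \<sigma> * Im (h z)"
    using assms unfolding image_in_half_plane_def by metis
  have \<sigma>0: "\<sigma> \<noteq> 0" using \<sigma> by auto
  define \<Phi> where "\<Phi> z = 1 / 2 - \<i> * of_real \<sigma> * h z - of_real m" for z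
  have Re\<Phi>: "1 / 2 < Re (\<Phi> z)" if "z \<in> unit_disk" for z
    using m [OF that] by (simp add: \<Phi>_def)
  have \<Phi>0: "\<Phi> z \<noteq> 0" if "z \<in> unit_disk" for z
    using Re\<Phi> [OF that] by auto
  define \<psi> where "\<psi> z = 1 - 1 / \<Phi> z" for z
  have "h holomorphic_on unit_disk"
    using h by (auto simp: Abel_function_def holomorphic_on_open)
  then have "\<psi> holomorphic_on unit_disk"
    unfolding \<psi>_def using \<Phi>0 unfolding \<Phi>_def by (intro holomorphic_intros) auto
  moreover have "inj_on \<psi> unit_disk"
    using Abel_function_inj [OF h] \<sigma>0 by (auto simp: inj_on_def \<psi>_def \<Phi>_def)
  moreover have "\<psi> ` unit_disk \<subseteq> unit_disk"
    using half_plane_to_disk [OF Re\<Phi>] unfolding \<psi>_def by blast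
  ultimately have "conformal_self_mapping \<psi>"
    by (simp add: conformal_self_mapping_def)
  moreover have "\<psi> (F t z) = half_plane_shift \<sigma> t (\<psi> z)" if "t \<ge> 0" "z \<in> unit_disk" for t z
  proof -
    have "\<Phi> (F t z) = \<Phi> z - \<i> * of_real (\<sigma> * t)"
      using Abel_equation [OF h that(2,1)] by (simp add: \<Phi>_def algebra_simps)
    then show ?thesis
      unfolding half_plane_shift_def \<psi>_def by simp
  qed
  ultimately have "outer_conjugate F (half_plane_shift \<sigma>)"
    unfolding outer_conjugate_def by blast
  then show ?thesis
    using half_plane_shift_parabolic_group [OF \<sigma>0] by blast
qed

text \<open>Members of the group commute, so those with \<open>t > 0\<close> all have the fixed
  point of \<open>G 1\<close>, and a single coordinate turns them into translations.\<close>

lemma parabolic_group_translations: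
  assumes G: "parabolic_group G"
  obtains \<zeta> b where "cmod \<zeta> = 1" "\<And>t. t > 0 \<Longrightarrow> Re (b t) = 0"
    "\<And>t z. t > 0 \<Longrightarrow> z \<in> unit_disk \<Longrightarrow> 1 / (1 - cnj \<zeta> * G t z) = 1 / (1 - cnj \<zeta> * z) + b t"
proof -
  have aut: "disk_automorphism (G t)" for t
    using G by (auto simp: parabolic_group_def)
  have maps: "G t ` unit_disk \<subseteq> unit_disk" for t
    using aut [of t] by (auto simp: disk_automorphism_def bij_betw_def)
  have comm: "G t (G s z) = G s (G t z)" if "z \<in> unit_disk" for t s z
    using G that unfolding parabolic_group_def by (metis add.commute)
  have "\<exists>\<zeta>. cmod \<zeta> = 1 \<and> only_fixed_point (G t) \<zeta>" if "t > 0" for t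
  proof -
    have "parabolic_automorphism (G t)" using G that by (simp add: parabolic_group_def)
    then obtain h \<zeta> where "continuous_on (cball 0 1) h" "\<forall>z\<in>unit_disk. h z = G t z" "\<zeta> \<in> sphere 0 1"
      "{z \<in> cball 0 1. h z = z} = {\<zeta>}"
      unfolding parabolic_automorphism_def by blast
    then show ?thesis
      unfolding only_fixed_point_def by (intro exI [of _ \<zeta>] conjI exI [of _ h]) simp_all
  qed
  then have "\<forall>t. \<exists>\<zeta>. t > 0 \<longrightarrow> cmod \<zeta> = 1 \<and> only_fixed_point (G t) \<zeta>" by blast
  from choice [OF this] obtain \<zeta> where \<zeta>: "\<And>t. t > 0 \<Longrightarrow> cmod (\<zeta> t) = 1"
      "\<And>t. t > 0 \<Longrightarrow> only_fixed_point (G t) (\<zeta> t)"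
    by blast
  have same: "\<zeta> t = \<zeta> 1" if "t > 0" for t
  proof (rule only_fixed_point_unique)
    show "only_fixed_point (G t) (\<zeta> t)" by (rule \<zeta>(2) [OF that])
    show "only_fixed_point (G 1) (\<zeta> 1)" by (rule \<zeta>(2)) simp
    show "G t ` unit_disk \<subseteq> unit_disk" "G 1 ` unit_disk \<subseteq> unit_disk" by (rule maps)+
    show "G t (G 1 z) = G 1 (G t z)" if "z \<in> unit_disk" for z by (rule comm [OF that])
  qed
  have "\<exists>b. Re b = 0 \<and> (\<forall>z\<in>unit_disk. 1 / (1 - cnj (\<zeta> 1) * G t z) = 1 / (1 - cnj (\<zeta> 1) * z) + b)"
    if "t > 0" for t
  proof -
    have ofp: "only_fixed_point (G t) (\<zeta> 1)"
      using \<zeta>(2) [OF that] unfolding same [OF that] .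
    show ?thesis
    proof (rule parabolic_automorphism_translation [OF aut ofp \<zeta>(1) [OF zero_less_one]])
      fix b assume "Re b = 0" "\<And>z. z \<in> unit_disk \<Longrightarrow> 1 / (1 - cnj (\<zeta> 1) * G t z) = 1 / (1 - cnj (\<zeta> 1) * z) + b"
      then show ?thesis by (intro exI [of _ b] conjI ballI)
    qed
  qed
  then have "\<forall>t. \<exists>b. t > 0 \<longrightarrow> Re b = 0 \<and>
      (\<forall>z\<in>unit_disk. 1 / (1 - cnj (\<zeta> 1) * G t z) = 1 / (1 - cnj (\<zeta> 1) * z) + b)"
    by blast
  from choice [OF this] obtain b where b: "\<And>t. t > 0 \<Longrightarrow> Re (b t) = 0" "\<And>t z. t > 0 \<Longrightarrow> z \<in> unit_disk \<Longrightarrow>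
      1 / (1 - cnj (\<zeta> 1) * G t z) = 1 / (1 - cnj (\<zeta> 1) * z) + b t"
    by blast
  show thesis
    by (rule that [OF \<zeta>(1) [OF zero_less_one] b])
qed

text \<open>In the coordinate of the group, \<open>\<Phi> (F t z) = \<Phi> z + b t\<close>.
  Differentiation at \<open>t = 0\<close> gives \<open>\<Phi> = \<beta> * h + k\<close> with \<beta>
  imaginary, nonzero by univalence of \<open>\<psi>\<close>, so \<open>Re (\<Phi> z) > 1 / 2\<close>
  bounds \<open>Im (h z)\<close> on one side.\<close>

lemma half_plane_if_outer_conjugate:
  assumes h: "Abel_function h" and G: "parabolic_group G" and "outer_conjugate F G"
  shows "image_in_half_plane h"
proof -
  obtain \<psi> where \<psi>: "\<psi> holomorphic_on unit_disk" "inj_on \<psi> unit_disk" "\<psi> ` unit_disk \<subseteq> unit_disk"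
    and conj: "\<And>t z. t \<ge> 0 \<Longrightarrow> z \<in> unit_disk \<Longrightarrow> \<psi> (F t z) = G t (\<psi> z)"
    using assms unfolding outer_conjugate_def conformal_self_mapping_def by blast
  obtain \<zeta> b where \<zeta>: "cmod \<zeta> = 1" and Reb: "\<And>t. t > 0 \<Longrightarrow> Re (b t) = 0"
    and tr: "\<And>t z. t > 0 \<Longrightarrow> z \<in> unit_disk \<Longrightarrow> 1 / (1 - cnj \<zeta> * G t z) = 1 / (1 - cnj \<zeta> * z) + b t"
    using parabolic_group_translations [OF G] by blast
  have \<psi>d: "\<psi> z \<in> unit_disk" if "z \<in> unit_disk" for z
    using \<psi>(3) that by blast
  then have rot: "cnj \<zeta> * \<psi> z \<in> unit_disk" if "z \<in> unit_disk" for z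
    using that \<zeta> by (simp add: norm_mult)
  define \<Phi> where "\<Phi> z = 1 / (1 - cnj \<zeta> * \<psi> z)" for z
  have Re\<Phi>: "1 / 2 < Re (\<Phi> z)" if "z \<in> unit_disk" for z
    unfolding \<Phi>_def by (rule disk_Re_gt_half [OF rot [OF that]])
  have nz: "1 - cnj \<zeta> * \<psi> z \<noteq> 0" if "z \<in> unit_disk" for z
    using rot [OF that] by auto
  have hol\<Phi>: "\<Phi> holomorphic_on unit_disk"
    unfolding \<Phi>_def using nz by (intro holomorphic_intros \<psi>(1)) auto
  have d\<Phi>: "(\<Phi> has_field_derivative deriv \<Phi> z) (at z)" if "z \<in> unit_disk" for z
    by (rule holomorphic_derivI [OF hol\<Phi> open_ball that])
  define \<beta> where "\<beta> = - deriv \<Phi> 0 * f 0"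
  \<comment> \<open>The left side does not involve \<open>z\<close>: this gives both the derivative
    of \<open>b\<close> at \<open>0\<close> and the independence of
    \<open>deriv \<Phi> z * f z\<close> from \<open>z\<close>.\<close>
  have lim: "((\<lambda>t. b t / of_real t) \<longlongrightarrow> - deriv \<Phi> z * f z) (at_right 0)" if z: "z \<in> unit_disk" for z
  proof (rule Lim_transform_eventually [OF chain_rule_at_zero [OF z d\<Phi> [OF z]]])
    show "\<forall>\<^sub>F t in at_right 0. (\<Phi> (F t z) - \<Phi> z) / of_real t = b t / of_real t"
      using tr [OF _ \<psi>d [OF z]] conj [OF _ z]
      by (auto simp: \<Phi>_def eventually_at_right_field intro!: exI [of _ 1])
  qed
  have lim\<beta>: "((\<lambda>t. b t / of_real t) \<longlongrightarrow> \<beta>) (at_right 0)"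
    unfolding \<beta>_def by (rule lim) simp
  have \<beta>: "deriv \<Phi> z = \<beta> * (- 1 / f z)" if z: "z \<in> unit_disk" for z
  proof -
    have eq: "\<beta> = - deriv \<Phi> z * f z"
      by (rule tendsto_unique [OF _ lim\<beta> lim [OF z]]) simp
    show ?thesis
      unfolding eq using generator_nonzero [OF z] by simp
  qed
  have Re\<beta>: "Re \<beta> = 0"
  proof (rule tendsto_unique [OF _ tendsto_Re [OF lim\<beta>]])
    show "((\<lambda>t. Re (b t / of_real t)) \<longlongrightarrow> 0) (at_right 0)"
      using Reb by (intro tendsto_eventually) (auto simp: eventually_at_right_field intro!: exI [of _ 1])
  qed simp
  have "((\<lambda>z. \<Phi> z - \<beta> * h z) has_field_derivative 0) (at z within unit_disk)" if z: "z \<in> unit_disk" for z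
  proof -
    have "(h has_field_derivative - 1 / f z) (at z)"
      using h z by (simp add: Abel_function_def)
    then have "((\<lambda>z. \<Phi> z - \<beta> * h z) has_field_derivative deriv \<Phi> z - \<beta> * (- 1 / f z)) (at z)"
      by (intro DERIV_diff d\<Phi> z DERIV_cmult)
    then show ?thesis
      using \<beta> [OF z] by (simp add: has_field_derivative_at_within)
  qed
  then obtain k where k: "\<And>z. z \<in> unit_disk \<Longrightarrow> \<Phi> z - \<beta> * h z = k"
    using has_field_derivative_zero_constant [OF convex_ball, of 0 1 "\<lambda>z. \<Phi> z - \<beta> * h z"] by blast
  have "\<beta> \<noteq> 0"
  proof
    assume "\<beta> = 0"
    then have "\<Phi> 0 = \<Phi> (1 / 2)" using k [of 0] k [of "1 / 2"] by (simp add: norm_divide)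
    then have "\<psi> 0 = \<psi> (1 / 2)" using \<zeta> by (auto simp: \<Phi>_def)
    then have "(0::complex) = 1 / 2"
      by (rule inj_onD [OF \<psi>(2)]) (auto simp: norm_divide)
    then show False by simp
  qed
  then have Im\<beta>: "Im \<beta> \<noteq> 0" using Re\<beta> by (simp add: complex_eq_iff)
  show ?thesis
    unfolding image_in_half_plane_def
  proof (intro exI conjI ballI)
    show "\<bar>- sgn (Im \<beta>)\<bar> = 1" using Im\<beta> by (simp add: sgn_if)
    fix z assume z: "z \<in> unit_disk"
    have "Re (\<Phi> z) = Re k - Im \<beta> * Im (h z)"
      using arg_cong [OF k [OF z], of Re] Re\<beta> by simp
    moreover have "Im \<beta> * Im (h z) = \<bar>Im \<beta>\<bar> * (sgn (Im \<beta>) * Im (h z))"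
      by (simp add: sgn_if)
    ultimately have "1 / 2 - Re k < \<bar>Im \<beta>\<bar> * (- sgn (Im \<beta>) * Im (h z))"
      using Re\<Phi> [OF z] by simp
    then show "(1 / 2 - Re k) / \<bar>Im \<beta>\<bar> < - sgn (Im \<beta>) * Im (h z)"
      using Im\<beta> by (simp add: divide_less_eq mult.commute)
  qed
qed

end

section \<open>Boundedness along trajectories\<close>

text \<open>The right side is twice the distance from \<open>\<Phi> z\<close> to the line
  \<open>Re = 1 / 2\<close>; the estimate is Schwarz-Pick for \<open>1 - 1 / \<Phi>\<close>.\<close>

lemma half_plane_Schwarz_Pick:
  assumes der: "\<And>z. z \<in> unit_disk \<Longrightarrow> (\<Phi> has_field_derivative \<Phi>' z) (at z)"
    and Re: "\<And>z. z \<in> unit_disk \<Longrightarrow> 1 / 2 < Re (\<Phi> z)" and z: "z \<in> unit_disk"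
  shows "(1 - (cmod z)\<^sup>2) * cmod (\<Phi>' z) \<le> 2 * Re (\<Phi> z) - 1"
proof -
  define \<psi> where "\<psi> z = 1 - 1 / \<Phi> z" for z
  have nz: "\<Phi> x \<noteq> 0" if "x \<in> unit_disk" for x
    using Re [OF that] by auto
  have d\<psi>: "(\<psi> has_field_derivative \<Phi>' x / (\<Phi> x)\<^sup>2) (at x)" if x: "x \<in> unit_disk" for x
  proof -
    have "((\<lambda>x. 1 - 1 / \<Phi> x) has_field_derivative (0 - (0 * \<Phi> x - 1 * \<Phi>' x) / (\<Phi> x * \<Phi> x))) (at x)"
      by (intro DERIV_diff DERIV_divide DERIV_const der x nz)
    then show ?thesis by (simp add: \<psi>_def [abs_def] power2_eq_square)
  qed
  have "\<psi> holomorphic_on unit_disk"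
    unfolding holomorphic_on_open [OF open_ball] using d\<psi> by blast
  moreover have im: "\<psi> ` unit_disk \<subseteq> unit_disk"
    unfolding \<psi>_def using half_plane_to_disk Re by blast
  ultimately have "(1 - (cmod z)\<^sup>2) * cmod (deriv \<psi> z) \<le> 1 - (cmod (\<psi> z))\<^sup>2"
    by (rule Schwarz_Pick(2) [OF _ _ z z])
  also have "deriv \<psi> z = \<Phi>' z / (\<Phi> z)\<^sup>2"
    by (rule DERIV_imp_deriv [OF d\<psi> [OF z]])
  finally have "(1 - (cmod z)\<^sup>2) * cmod (\<Phi>' z) / (cmod (\<Phi> z))\<^sup>2 \<le> 1 - (cmod (\<psi> z))\<^sup>2"
    by (simp add: norm_divide norm_power)
  then have "(1 - (cmod z)\<^sup>2) * cmod (\<Phi>' z) \<le> (1 - (cmod (\<psi> z))\<^sup>2) * (cmod (\<Phi> z))\<^sup>2"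
    using nz [OF z] by (simp add: divide_le_eq)
  also have "\<dots> = (1 - (cmod (\<psi> z))\<^sup>2) / (cmod (1 - \<psi> z))\<^sup>2"
    by (simp add: \<psi>_def norm_divide power_divide)
  also have "\<dots> = 2 * Re (1 / (1 - \<psi> z)) - 1"
    using nz [OF z] by (intro horodisk_Re_eq) (auto simp: \<psi>_def)
  also have "1 / (1 - \<psi> z) = \<Phi> z"
    by (simp add: \<psi>_def)
  finally show ?thesis .
qed

text \<open>The companion lower bound: Schwarz-Pick at \<open>0\<close> for the inverse of
  \<open>h\<close>, composed with the affine map of the unit disk onto the ball.\<close>

lemma ball_in_image_radius:
  assumes der: "\<And>z. z \<in> unit_disk \<Longrightarrow> (h has_field_derivative h' z) (at z)"
    and inj: "inj_on h unit_disk" and z: "z \<in> unit_disk"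
    and d: "d > 0" and sub: "ball (h z) d \<subseteq> h ` unit_disk"
  shows "d \<le> (1 - (cmod z)\<^sup>2) * cmod (h' z)"
proof -
  have holh: "h holomorphic_on unit_disk"
    unfolding holomorphic_on_open [OF open_ball] using der by blast
  obtain g where g: "g holomorphic_on h ` unit_disk"
      "\<And>x. x \<in> unit_disk \<Longrightarrow> deriv h x * deriv g (h x) = 1" "\<And>x. x \<in> unit_disk \<Longrightarrow> g (h x) = x"
    using holomorphic_has_inverse [OF holh open_ball inj] by metis
  have op: "open (h ` unit_disk)"
    by (rule open_mapping_thm3 [OF holh open_ball inj])
  have dh: "deriv h z = h' z"
    by (rule DERIV_imp_deriv [OF der [OF z]])
  define k where "k \<xi> = g (h z + of_real d * \<xi>)" for \<xi>
  have arg: "h z + of_real d * \<xi> \<in> h ` unit_disk" if "\<xi> \<in> unit_disk" for \<xi>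
  proof -
    have "h z + of_real d * \<xi> \<in> ball (h z) d"
      using that d by (simp add: dist_norm norm_mult)
    then show ?thesis using sub by blast
  qed
  have dk: "(k has_field_derivative deriv g (h z + of_real d * \<xi>) * of_real d) (at \<xi>)"
    if "\<xi> \<in> unit_disk" for \<xi>
  proof -
    have "(g has_field_derivative deriv g (h z + of_real d * \<xi>)) (at (h z + of_real d * \<xi>))"
      by (rule holomorphic_derivI [OF g(1) op arg [OF that]])
    moreover have "((\<lambda>\<xi>. h z + of_real d * \<xi>) has_field_derivative of_real d) (at \<xi>)"
      by (auto intro!: derivative_eq_intros)
    ultimately show ?thesis
      unfolding k_def by (rule DERIV_chain2)
  qed
  have "k holomorphic_on unit_disk"
    unfolding holomorphic_on_open [OF open_ball] using dk by blast
  moreover have "k \<xi> \<in> unit_disk" if \<xi>: "\<xi> \<in> unit_disk" for \<xi>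
  proof -
    obtain x where "x \<in> unit_disk" "h z + of_real d * \<xi> = h x"
      using arg [OF \<xi>] by blast
    then show ?thesis using g(3) by (simp add: k_def)
  qed
  then have "k ` unit_disk \<subseteq> unit_disk" by blast
  ultimately have "(1 - (cmod (0::complex))\<^sup>2) * cmod (deriv k 0) \<le> 1 - (cmod (k 0))\<^sup>2"
    by (rule Schwarz_Pick(2) [of k 0 0]) auto
  moreover have "deriv k 0 = deriv g (h z) * of_real d"
    using DERIV_imp_deriv [OF dk [of 0]] by simp
  moreover have "k 0 = z"
    using g(3) [OF z] by (simp add: k_def)
  ultimately have "cmod (deriv g (h z)) * d \<le> 1 - (cmod z)\<^sup>2"
    using d by (simp add: norm_mult)
  then have "cmod (deriv g (h z)) * d * cmod (h' z) \<le> (1 - (cmod z)\<^sup>2) * cmod (h' z)"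
    by (rule mult_right_mono) simp
  also have "cmod (deriv g (h z)) * d * cmod (h' z) = d * cmod (deriv h z * deriv g (h z))"
    by (simp only: norm_mult dh mult_ac)
  also have "\<dots> = d"
    by (simp only: g(2) [OF z] norm_one mult_1_right)
  finally show ?thesis .
qed

text \<open>A limit point \<open>y\<close> of the ordinates of the omitted points yields an omitted horizontal line,
  because the omitted set is closed and invariant under translation to the left.\<close>

lemma half_plane_if_omitted_points:
  assumes op: "open \<Omega>" and con: "connected \<Omega>"
    and trans: "\<And>w t. w \<in> \<Omega> \<Longrightarrow> t \<ge> 0 \<Longrightarrow> w + of_real t \<in> \<Omega>"
    and omit: "\<And>n::nat. n \<ge> N \<Longrightarrow> \<exists>w. w \<notin> \<Omega> \<and> cmod (w - (w0 + of_nat n)) \<le> D"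
  obtains y where "(\<forall>w\<in>\<Omega>. y < Im w) \<or> (\<forall>w\<in>\<Omega>. Im w < y)"
proof -
  have "\<forall>n. \<exists>w. w \<notin> \<Omega> \<and> cmod (w - (w0 + of_nat (n + N))) \<le> D"
    using omit le_add2 by blast
  from choice [OF this] obtain w where w: "\<And>n. w n \<notin> \<Omega>" "\<And>n. cmod (w n - (w0 + of_nat (n + N))) \<le> D"
    by blast
  have "\<bar>Im (w n) - Im w0\<bar> \<le> D" for n
    using abs_Im_le_cmod [of "w n - (w0 + of_nat (n + N))"] w(2) [of n] by simp
  then have bounded: "\<forall>n. Im (w n) \<in> {Im w0 - D..Im w0 + D}"
    by (simp add: abs_le_iff algebra_simps)
  have "seq_compact {Im w0 - D..Im w0 + D}"
    by (intro compact_imp_seq_compact compact_Icc)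
  from seq_compactE [OF this bounded]
  obtain y and r :: "nat \<Rightarrow> nat" where r: "strict_mono r" and "((\<lambda>n. Im (w n)) \<circ> r) \<longlonglongrightarrow> y"
    by blast
  then have y: "(\<lambda>n. Im (w (r n))) \<longlonglongrightarrow> y"
    by (simp add: o_def)
  have miss: "v \<notin> \<Omega>" if v: "Im v = y" for v
  proof
    assume "v \<in> \<Omega>"
    then obtain e where e: "e > 0" "ball v e \<subseteq> \<Omega>"
      using op open_contains_ball by blast
    have "\<forall>\<^sub>F n in sequentially. dist (Im (w (r n))) y < e"
      using tendstoD [OF y \<open>e > 0\<close>] .
    then obtain n0 where n0: "\<And>n. n \<ge> n0 \<Longrightarrow> dist (Im (w (r n))) y < e"
      by (auto simp: eventually_sequentially)
    \<comment> \<open>Far enough along the sequence the omitted point \<open>x\<close> lies to the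
      right of \<open>v\<close>. A point of the ball at the height of \<open>x\<close> could then be
      translated onto it.\<close>
    obtain n1 :: nat where n1: "Re v - Re w0 + D \<le> n1"
      using real_arch_simple by blast
    define n where "n = max n0 n1"
    define x where "x = w (r n)"
    have "\<bar>Re x - (Re w0 + real (r n + N))\<bar> \<le> D"
      using abs_Re_le_cmod [of "x - (w0 + of_nat (r n + N))"] w(2) [of "r n"] by (simp add: x_def)
    moreover have "n1 \<le> r n"
      using seq_suble [OF r, of n] by (simp add: n_def)
    then have "real n1 \<le> real (r n + N)" by simp
    ultimately have Rex: "Re v \<le> Re x"
      using n1 by linarith
    have "dist (Im x) y < e" using n0 [of n] by (simp add: n_def x_def)
    then have "cmod (v - Complex (Re v) (Im x)) < e"
      using v by (simp add: cmod_def dist_real_def power2_eq_square abs_minus_commute)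
    then have "Complex (Re v) (Im x) \<in> \<Omega>"
      using e by (auto simp: dist_norm subset_iff)
    then have "Complex (Re v) (Im x) + of_real (Re x - Re v) \<in> \<Omega>"
      using Rex by (intro trans) auto
    also have "Complex (Re v) (Im x) + of_real (Re x - Re v) = x"
      by (simp add: complex_eq_iff)
    finally show False
      using w(1) by (simp add: x_def)
  qed
  have "connected (Im ` \<Omega>)"
    by (intro connected_continuous_image con continuous_intros)
  have "\<not> (\<exists>p\<in>\<Omega>. \<exists>q\<in>\<Omega>. Im p \<le> y \<and> y \<le> Im q)"
  proof
    assume "\<exists>p\<in>\<Omega>. \<exists>q\<in>\<Omega>. Im p \<le> y \<and> y \<le> Im q"
    then obtain p q where pq: "p \<in> \<Omega>" "q \<in> \<Omega>" "Im p \<le> y" "y \<le> Im q" by blast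
    have "{Im p..Im q} \<subseteq> Im ` \<Omega>"
      using pq by (intro connected_contains_Icc [OF \<open>connected (Im ` \<Omega>)\<close>]) auto
    then have "y \<in> Im ` \<Omega>" using pq by auto
    then show False using miss by auto
  qed
  then have "(\<forall>w\<in>\<Omega>. y < Im w) \<or> (\<forall>w\<in>\<Omega>. Im w < y)"
    by (meson not_le)
  then show thesis by (rule that)
qed

section \<open>Sectors contained in a half-plane\<close>

text \<open>The angles \<open>\<alpha> * (\<theta>' - \<theta>)\<close> fill an open interval of
  length \<open>\<alpha> * pi\<close> with \<open>0\<close> in its closure. As \<open>sin\<close> is
  negative just to the left of \<open>0\<close>, the interval must start at \<open>0\<close>, and it
  must not extend beyond \<open>pi\<close>.\<close>

lemma sin_sector_pos:
  fixes \<alpha> \<theta>' :: real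
  assumes \<alpha>: "\<alpha> > 0" and \<theta>': "\<bar>\<theta>'\<bar> \<le> pi / 2"
    and nn: "\<And>\<theta>. \<bar>\<theta>\<bar> < pi / 2 \<Longrightarrow> 0 \<le> sin (\<alpha> * (\<theta>' - \<theta>))"
  shows "\<alpha> \<le> 1 \<and> \<theta>' = pi / 2"
proof -
  have eq: "\<theta>' = pi / 2"
  proof (rule ccontr)
    assume "\<theta>' \<noteq> pi / 2"
    then have lt: "\<theta>' < pi / 2" using \<theta>' by simp
    define m where "m = pi / 2 - \<theta>'"
    define q where "q = pi / \<alpha>"
    have p: "m > 0" "q > 0" "\<alpha> * q = pi" using lt \<alpha> by (auto simp: m_def q_def)
    define \<delta> where "\<delta> = min m q / 2"
    have \<delta>: "\<delta> > 0" "\<delta> < m" "\<delta> < q" using p by (auto simp: \<delta>_def min_def)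
    have \<delta>1: "\<theta>' + \<delta> < pi / 2" using \<delta>(2) by (simp add: m_def)
    have \<delta>2: "\<alpha> * \<delta> < pi" using mult_strict_left_mono [OF \<delta>(3) \<alpha>] p(3) by simp
    have "0 \<le> sin (\<alpha> * (\<theta>' - (\<theta>' + \<delta>)))"
      using \<delta> \<delta>1 \<theta>' by (intro nn) linarith
    then have "sin (\<alpha> * \<delta>) \<le> 0" by simp
    moreover have "sin (\<alpha> * \<delta>) > 0"
      using \<delta> \<delta>2 \<alpha> by (intro sin_gt_zero) auto
    ultimately show False by simp
  qed
  moreover have "\<alpha> \<le> 1"
  proof (rule ccontr)
    assume "\<not> \<alpha> \<le> 1"
    then have \<alpha>1: "\<alpha> > 1" by simp
    define q where "q = pi / \<alpha>"
    have q: "0 < q" "q < pi" "\<alpha> * q = pi" using \<alpha>1 by (auto simp: q_def field_simps)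
    \<comment> \<open>Any point above \<open>pi / \<alpha>\<close> and below both \<open>pi\<close>
      and \<open>2 * pi / \<alpha>\<close> serves; there \<open>\<alpha> * x\<close> lies between
      \<open>pi\<close> and \<open>2 * pi\<close>.\<close>
    define x where "x = min ((q + pi) / 2) (3 / 2 * q)"
    have x: "q < x" "x < pi" "x < 2 * q"
      using q by (auto simp: x_def min_def)
    then have \<alpha>x: "pi < \<alpha> * x" "\<alpha> * x < 2 * pi"
      using mult_strict_left_mono [OF x(1) \<alpha>] mult_strict_left_mono [OF x(3) \<alpha>] q(3) by simp_all
    have "0 \<le> sin (\<alpha> * (\<theta>' - (pi / 2 - x)))"
    proof (rule nn)
      have "0 < x" using x(1) q(1) by (rule less_trans [rotated])
      then show "\<bar>pi / 2 - x\<bar> < pi / 2"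
        using x(2) unfolding abs_less_iff by (simp add: field_simps)
    qed
    then have "0 \<le> sin (\<alpha> * x)" using eq by simp
    moreover have "sin (\<alpha> * x) < 0"
      using \<alpha>x by (intro sin_lt_zero)
    ultimately show False by simp
  qed
  ultimately show ?thesis by simp
qed

lemma sin_sector:
  fixes \<alpha> \<theta>' \<sigma> :: real
  assumes \<alpha>: "\<alpha> > 0" and \<theta>': "\<bar>\<theta>'\<bar> \<le> pi / 2" and \<sigma>: "\<bar>\<sigma>\<bar> = 1"
    and nn: "\<And>\<theta>. \<bar>\<theta>\<bar> < pi / 2 \<Longrightarrow> 0 \<le> \<sigma> * sin (\<alpha> * (\<theta>' - \<theta>))"
  shows "\<alpha> \<le> 1 \<and> \<bar>\<theta>'\<bar> = pi / 2"
proof (cases "\<sigma> = 1")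
  case True
  then have "\<alpha> \<le> 1 \<and> \<theta>' = pi / 2"
    using sin_sector_pos [OF \<alpha> \<theta>'] nn by simp
  then show ?thesis using pi_gt_zero by (simp del: pi_gt_zero)
next
  case False
  then have s: "\<sigma> = - 1" using \<sigma> by linarith
  have "\<alpha> \<le> 1 \<and> - \<theta>' = pi / 2"
  proof (rule sin_sector_pos [OF \<alpha>])
    fix \<theta> :: real assume "\<bar>\<theta>\<bar> < pi / 2"
    then have "0 \<le> - sin (\<alpha> * (\<theta>' + \<theta>))"
      using nn [of "- \<theta>"] s by simp
    also have "\<dots> = sin (\<alpha> * (- \<theta>' - \<theta>))"
      by (simp add: algebra_simps flip: sin_minus)
    finally show "0 \<le> sin (\<alpha> * (- \<theta>' - \<theta>))" .
  qed (use \<theta>' in simp)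
  moreover from this have "\<theta>' = - (pi / 2)" by linarith
  ultimately show ?thesis by simp
qed

lemma powr_of_real_polar:
  assumes "z \<noteq> 0"
  shows "z powr of_real \<alpha> = of_real (cmod z powr \<alpha>) * cis (\<alpha> * Arg z)"
  by (intro complex_eqI) (simp_all add: assms powr_def Re_exp Im_exp Arg_eq_Im_Ln)

section \<open>Trajectories of a semigroup of order \<alpha>\<close>

locale disk_semigroup_of_order = disk_semigroup +
  fixes \<alpha> :: real and a :: complex
  assumes \<alpha>_pos: "\<alpha> > 0" and a_nonzero: "a \<noteq> 0"
    and order_limit: "((\<lambda>z. f z / (1 - z) powr of_real (1 + \<alpha>)) \<longlongrightarrow> a) (at 1 within unit_disk)"
begin

definition leading_coeff :: complex where "leading_coeff = - 1 / (of_real \<alpha> * a)"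

lemma leading_coeff_nonzero: "leading_coeff \<noteq> 0"
  using \<alpha>_pos a_nonzero by (simp add: leading_coeff_def)

lemma trajectory_at_1:
  assumes z: "z \<in> unit_disk"
  shows "filterlim (\<lambda>t. F t z) (at 1 within unit_disk) at_top"
  unfolding filterlim_at
proof
  show "\<forall>\<^sub>F t in at_top. F t z \<in> unit_disk \<and> F t z \<noteq> 1"
    using eventually_ge_at_top [of 0]
  proof eventually_elim
    fix t :: real assume "0 \<le> t"
    then have "F t z \<in> unit_disk" by (rule F_in [OF _ z])
    then show "F t z \<in> unit_disk \<and> F t z \<noteq> 1" by auto
  qed
qed (rule F_tendsto_1 [OF z])

lemma one_minus_trajectory_nonzero: "t \<ge> 0 \<Longrightarrow> z \<in> unit_disk \<Longrightarrow> 1 - F t z \<noteq> 0"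
  using F_in by force

lemma Abel_asymptotics:
  assumes h: "Abel_function h"
  shows "((\<lambda>z. h z * (1 - z) powr of_real \<alpha>) \<longlongrightarrow> leading_coeff) (at 1 within unit_disk)"
proof (rule tendsto_times_powr_of_deriv [OF \<alpha>_pos])
  show "(h has_field_derivative - 1 / f z) (at z)" if "z \<in> unit_disk" for z
    using h that by (simp add: Abel_function_def)
  have "((\<lambda>z. - inverse (f z / (1 - z) powr of_real (1 + \<alpha>))) \<longlongrightarrow> - inverse a) (at 1 within unit_disk)"
    by (intro tendsto_minus tendsto_inverse order_limit a_nonzero)
  moreover have "- inverse a = of_real \<alpha> * leading_coeff"
    using \<alpha>_pos by (simp add: leading_coeff_def divide_inverse)
  ultimately show "((\<lambda>z. - 1 / f z * (1 - z) powr of_real (1 + \<alpha>)) \<longlongrightarrow> of_real \<alpha> * leading_coeff) (at 1 within unit_disk)"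
    by (simp add: divide_inverse mult.commute)
qed

text \<open>In the asymptotics of \<open>h\<close> along a trajectory, \<open>h (F t z)\<close> is
  \<open>h z + t\<close>, and the constant \<open>h z\<close> is killed by the vanishing
  power.\<close>

lemma time_asymptotics:
  assumes z: "z \<in> unit_disk"
  shows "((\<lambda>t. of_real t * (1 - F t z) powr of_real \<alpha>) \<longlongrightarrow> leading_coeff) at_top"
proof -
  obtain h where h: "Abel_function h" by (rule Abel_function_exists)
  have "((\<lambda>t. cmod (1 - F t z)) \<longlongrightarrow> 0) at_top"
    using F_tendsto_1 [OF z] by (intro tendsto_eq_intros refl | simp)+
  then have "((\<lambda>t. cmod (1 - F t z) powr \<alpha>) \<longlongrightarrow> 0) at_top"
    by (rule tendsto_zero_powrI) (use \<alpha>_pos in auto)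
  then have "((\<lambda>t. cmod ((1 - F t z) powr of_real \<alpha>)) \<longlongrightarrow> 0) at_top"
    by (simp only: cmod_powr_of_real)
  then have "((\<lambda>t. h z * (1 - F t z) powr of_real \<alpha>) \<longlongrightarrow> 0) at_top"
    by (intro tendsto_mult_right_zero) (simp only: tendsto_norm_zero_iff)
  moreover have "((\<lambda>t. h (F t z) * (1 - F t z) powr of_real \<alpha>) \<longlongrightarrow> leading_coeff) at_top"
    by (rule filterlim_compose [OF Abel_asymptotics [OF h] trajectory_at_1 [OF z]])
  ultimately have lim: "((\<lambda>t. h (F t z) * (1 - F t z) powr of_real \<alpha> - h z * (1 - F t z) powr of_real \<alpha>) \<longlongrightarrow> leading_coeff - 0) at_top"
    by (intro tendsto_diff)
  have "((\<lambda>t. of_real t * (1 - F t z) powr of_real \<alpha>) \<longlongrightarrow> leading_coeff - 0) at_top"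
  proof (rule Lim_transform_eventually [OF lim])
    show "\<forall>\<^sub>F t in at_top. h (F t z) * (1 - F t z) powr of_real \<alpha> - h z * (1 - F t z) powr of_real \<alpha>
        = of_real t * (1 - F t z) powr of_real \<alpha>"
      using eventually_ge_at_top [of 0]
      by eventually_elim (simp add: Abel_equation [OF h z] algebra_simps)
  qed
  then show ?thesis by simp
qed

text \<open>This exchanges \<open>t / cmod (1 - F t z)\<close> for the size of the derivative of
  \<open>h\<close> at \<open>F t z\<close>, turning the quotient of the boundedness condition into a
  Schwarz-Pick quantity. The limit is \<alpha> because
  \<open>cmod a * cmod leading_coeff = 1 / \<alpha>\<close>.\<close>

lemma generator_ratio:
  assumes z: "z \<in> unit_disk"
  shows "((\<lambda>t. cmod (1 / f (F t z)) * cmod (1 - F t z) / t) \<longlongrightarrow> \<alpha>) at_top"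
proof -
  have "((\<lambda>t. cmod (f (F t z) / (1 - F t z) powr of_real (1 + \<alpha>))) \<longlongrightarrow> cmod a) at_top"
    by (intro tendsto_norm filterlim_compose [OF order_limit trajectory_at_1 [OF z]])
  then have "((\<lambda>t. 1 / (cmod (f (F t z) / (1 - F t z) powr of_real (1 + \<alpha>)) * cmod (of_real t * (1 - F t z) powr of_real \<alpha>)))
      \<longlongrightarrow> 1 / (cmod a * cmod leading_coeff)) at_top"
    by (rule tendsto_divide [OF tendsto_const tendsto_mult [OF _ tendsto_norm [OF time_asymptotics [OF z]]]])
      (use a_nonzero leading_coeff_nonzero in simp)
  also have "1 / (cmod a * cmod leading_coeff) = \<alpha>"
    using a_nonzero \<alpha>_pos by (simp add: leading_coeff_def norm_divide norm_mult)
  finally show ?thesis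
  proof (rule Lim_transform_eventually)
    show "\<forall>\<^sub>F t in at_top. 1 / (cmod (f (F t z) / (1 - F t z) powr of_real (1 + \<alpha>)) * cmod (of_real t * (1 - F t z) powr of_real \<alpha>))
       = cmod (1 / f (F t z)) * cmod (1 - F t z) / t"
      using eventually_gt_at_top [of 0]
    proof eventually_elim
      fix t :: real assume t: "0 < t"
      have nz: "cmod (1 - F t z) > 0" "f (F t z) \<noteq> 0"
        using one_minus_trajectory_nonzero [OF _ z] generator_nonzero [OF F_in [OF _ z]] t by auto
      have "cmod (1 - F t z) powr (1 + \<alpha>) = cmod (1 - F t z) * cmod (1 - F t z) powr \<alpha>"
        using nz by (simp add: powr_add)
      moreover have "cmod (1 - F t z) powr \<alpha> > 0" using nz by simp
      ultimately show "1 / (cmod (f (F t z) / (1 - F t z) powr of_real (1 + \<alpha>)) * cmod (of_real t * (1 - F t z) powr of_real \<alpha>))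
       = cmod (1 / f (F t z)) * cmod (1 - F t z) / t"
        unfolding norm_divide norm_mult cmod_powr_of_real using t nz by (simp add: field_simps)
    qed
  qed
qed

text \<open>\<open>Im (h (F t z))\<close> does not change with \<open>t\<close>, so the distance to
  the boundary of the half-plane, and with it the Schwarz-Pick bound \<open>C\<close>, is the same
  along the whole trajectory.\<close>

lemma bounded_if_half_plane:
  assumes h: "Abel_function h" and hp: "image_in_half_plane h" and z: "z \<in> unit_disk"
  shows "bdd_above ((\<lambda>t. t * (1 - cmod (F t z)) / cmod (1 - F t z)) ` {0..})"
proof -
  obtain \<sigma> m where \<sigma>: "\<bar>\<sigma>\<bar> = 1" and m: "\<And>z. z \<in> unit_disk \<Longrightarrow> m < \<sigma> * Im (h z)"
    using hp unfolding image_in_half_plane_def by metis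
  define C where "C = 2 * (\<sigma> * Im (h z) - m)"
  have P: "(1 - (cmod (F t z))\<^sup>2) * cmod (1 / f (F t z)) \<le> C" if t: "t \<ge> 0" for t
  proof -
    define \<Phi> where "\<Phi> x = of_real (1 / 2 - m) - \<i> * of_real \<sigma> * h x" for x
    have "(1 - (cmod (F t z))\<^sup>2) * cmod (0 - \<i> * of_real \<sigma> * (- 1 / f (F t z))) \<le> 2 * Re (\<Phi> (F t z)) - 1"
    proof (rule half_plane_Schwarz_Pick [OF _ _ F_in [OF t z]])
      fix x assume x: "x \<in> unit_disk"
      show "1 / 2 < Re (\<Phi> x)" using m [OF x] by (simp add: \<Phi>_def)
      show "(\<Phi> has_field_derivative 0 - \<i> * of_real \<sigma> * (- 1 / f x)) (at x)"
        unfolding \<Phi>_def using h x unfolding Abel_function_def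
        by (intro DERIV_diff DERIV_const DERIV_cmult) blast
    qed
    moreover have "2 * Re (\<Phi> (F t z)) - 1 = C"
      using Abel_equation [OF h z t] by (simp add: \<Phi>_def C_def)
    moreover have "cmod (0 - \<i> * of_real \<sigma> * (- 1 / f (F t z))) = cmod (1 / f (F t z))"
      using \<sigma> by (simp add: norm_mult norm_divide)
    ultimately show ?thesis by (simp only:)
  qed
  have "C \<ge> 0" using m [OF z] by (simp add: C_def)
  have "\<forall>\<^sub>F t in at_top. \<alpha> / 2 < cmod (1 / f (F t z)) * cmod (1 - F t z) / t"
    by (rule order_tendstoD(1) [OF generator_ratio [OF z]]) (use \<alpha>_pos in simp)
  then obtain T where T: "\<And>t. t > T \<Longrightarrow> \<alpha> / 2 < cmod (1 / f (F t z)) * cmod (1 - F t z) / t"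
    by (auto simp: eventually_at_top_dense)
  \<comment> \<open>Up to time \<open>T\<close> the quotient is at most \<open>t\<close>, since
    \<open>1 - v \<le> u\<close>; afterwards the lower bound \<open>\<alpha> / 2\<close> for the
    ratio applies.\<close>
  have "t * (1 - cmod (F t z)) / cmod (1 - F t z) \<le> max T (2 * C / \<alpha>)" if t: "t \<ge> 0" for t
  proof -
    define u where "u = cmod (1 - F t z)"
    define v where "v = cmod (F t z)"
    have u: "u > 0" using one_minus_trajectory_nonzero [OF t z] by (simp add: u_def)
    have v: "0 \<le> v" "v < 1" using F_in [OF t z] by (simp_all add: v_def)
    show ?thesis
    proof (cases "t \<le> T")
      case True
      have "1 - v \<le> u"
        using norm_triangle_ineq2 [of 1 "F t z"] by (simp add: u_def v_def)
      then have "t * (1 - v) / u \<le> t"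
        using t u by (simp add: divide_le_eq mult_left_mono)
      then show ?thesis using True by (simp add: u_def v_def)
    next
      case False
      have "t > 0" using False t T [of t] \<alpha>_pos by (cases "t = 0") auto
      have "\<alpha> / 2 * t < cmod (1 / f (F t z)) * u"
        using T [of t] False \<open>t > 0\<close> by (simp add: u_def pos_less_divide_eq)
      then have "\<alpha> / 2 * t * (1 - v) \<le> cmod (1 / f (F t z)) * u * (1 - v)"
        using v by (intro mult_right_mono) auto
      also have "\<dots> = (1 - v) * cmod (1 / f (F t z)) * u"
        by (simp only: mult_ac)
      also have "\<dots> \<le> (1 - v\<^sup>2) * cmod (1 / f (F t z)) * u"
        using v u by (intro mult_right_mono) (auto simp: power2_eq_square mult_left_le)
      also have "\<dots> \<le> C * u"
        using P [OF t] u by (intro mult_right_mono) (auto simp: v_def)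
      finally have "t * (1 - v) / u \<le> 2 * C / \<alpha>"
        using u \<alpha>_pos by (simp add: field_simps)
      then show ?thesis by (simp add: u_def v_def)
    qed
  qed
  then show ?thesis by (intro bdd_aboveI2) auto
qed

text \<open>One bounded trajectory already bounds the radii of the disks around
  \<open>h z + n\<close> contained in the image, so points are omitted at bounded distance from
  these centres.\<close>

lemma half_plane_if_bounded:
  assumes h: "Abel_function h" and z: "z \<in> unit_disk"
    and bdd: "bdd_above ((\<lambda>t. t * (1 - cmod (F t z)) / cmod (1 - F t z)) ` {0..})"
  shows "image_in_half_plane h"
proof -
  have der: "(h has_field_derivative - 1 / f x) (at x)" if "x \<in> unit_disk" for x
    using h that by (simp add: Abel_function_def)
  have holh: "h holomorphic_on unit_disk"
    unfolding holomorphic_on_open [OF open_ball] using der by blast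
  have inj: "inj_on h unit_disk" by (rule Abel_function_inj [OF h])
  obtain M where M: "\<And>t. t \<ge> 0 \<Longrightarrow> t * (1 - cmod (F t z)) / cmod (1 - F t z) \<le> M"
    using bdd unfolding bdd_above_def by auto
  have "\<forall>\<^sub>F t in at_top. cmod (1 / f (F t z)) * cmod (1 - F t z) / t < 2 * \<alpha>"
    by (rule order_tendstoD(2) [OF generator_ratio [OF z]]) (use \<alpha>_pos in simp)
  then obtain T where T: "\<And>t. t > T \<Longrightarrow> cmod (1 / f (F t z)) * cmod (1 - F t z) / t < 2 * \<alpha>"
    by (auto simp: eventually_at_top_dense)
  \<comment> \<open>The factor \<open>4 * \<alpha>\<close> combines the upper bound
    \<open>2 * \<alpha>\<close> for the ratio with
    \<open>1 - v ^ 2 \<le> 2 * (1 - v)\<close>.\<close>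
  have P: "(1 - (cmod (F t z))\<^sup>2) * cmod (- 1 / f (F t z)) \<le> 4 * \<alpha> * M" if t: "t > max 0 T" for t
  proof -
    define u where "u = cmod (1 - F t z)"
    define v where "v = cmod (F t z)"
    have t0: "t \<ge> 0" "t > 0" "t > T" using t by auto
    have u: "u > 0" using one_minus_trajectory_nonzero [OF t0(1) z] by (simp add: u_def)
    have v: "0 \<le> v" "v < 1" using F_in [OF t0(1) z] by (simp_all add: v_def)
    have "cmod (1 / f (F t z)) * u \<le> 2 * \<alpha> * t"
      using T [OF t0(3)] t0(2) by (simp add: u_def pos_divide_less_eq less_imp_le)
    then have "cmod (1 / f (F t z)) \<le> 2 * \<alpha> * t / u"
      using u by (simp add: pos_le_divide_eq)
    moreover have "1 - v\<^sup>2 \<le> 2 * (1 - v)"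
      using zero_le_power2 [of "1 - v"] by (simp add: power2_eq_square algebra_simps)
    ultimately have "(1 - v\<^sup>2) * cmod (1 / f (F t z)) \<le> (2 * (1 - v)) * (2 * \<alpha> * t / u)"
      using v by (intro mult_mono) auto
    also have "\<dots> = 4 * \<alpha> * (t * (1 - v) / u)"
      by simp
    also have "\<dots> \<le> 4 * \<alpha> * M"
      using M [OF t0(1)] \<alpha>_pos by (intro mult_left_mono) (auto simp: u_def v_def)
    finally show ?thesis by (simp add: v_def norm_divide)
  qed
  \<comment> \<open>Positive and strictly larger than the bound \<open>4 * \<alpha> * M\<close> of
    \<open>P\<close>.\<close>
  define D where "D = \<bar>4 * \<alpha> * M\<bar> + 1"
  define N where "N = nat \<lceil>max 0 T\<rceil> + 1"
  have omit: "\<exists>w. w \<notin> h ` unit_disk \<and> cmod (w - (h z + of_nat n)) \<le> D" if n: "n \<ge> N" for n :: nat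
  proof (rule ccontr)
    assume neg: "\<not> ?thesis"
    have nT: "real n > max 0 T" using n unfolding N_def by linarith
    have hn: "h (F (real n) z) = h z + of_nat n"
      using Abel_equation [OF h z, of "real n"] by simp
    have "ball (h (F (real n) z)) D \<subseteq> h ` unit_disk"
    proof
      fix w assume "w \<in> ball (h (F (real n) z)) D"
      then have "cmod (w - (h z + of_nat n)) \<le> D"
        by (simp add: hn dist_norm norm_minus_commute)
      then show "w \<in> h ` unit_disk" using neg by blast
    qed
    then have "D \<le> (1 - (cmod (F (real n) z))\<^sup>2) * cmod (- 1 / f (F (real n) z))"
      by (intro ball_in_image_radius [OF der inj F_in [OF _ z]]) (auto simp: D_def)
    also have "\<dots> \<le> 4 * \<alpha> * M" by (rule P [OF nT])
    finally show False by (simp add: D_def)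
  qed
  have "open (h ` unit_disk)"
    by (rule open_mapping_thm3 [OF holh open_ball inj])
  moreover have "connected (h ` unit_disk)"
    by (intro connected_continuous_image holomorphic_on_imp_continuous_on holh connected_ball)
  moreover have "w + of_real t \<in> h ` unit_disk" if "w \<in> h ` unit_disk" "t \<ge> 0" for w t
  proof -
    obtain x where x: "x \<in> unit_disk" "w = h x" using \<open>w \<in> h ` unit_disk\<close> by blast
    then have "w + of_real t = h (F t x)" using Abel_equation [OF h x(1) \<open>t \<ge> 0\<close>] by simp
    then show ?thesis using F_in [OF \<open>t \<ge> 0\<close> x(1)] by blast
  qed
  ultimately obtain y where "(\<forall>w\<in>h ` unit_disk. y < Im w) \<or> (\<forall>w\<in>h ` unit_disk. Im w < y)"
    by (rule half_plane_if_omitted_points [OF _ _ _ omit])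
  then show ?thesis
  proof
    assume "\<forall>w\<in>h ` unit_disk. y < Im w"
    then show ?thesis
      unfolding image_in_half_plane_def by (intro exI [of _ 1] exI [of _ y]) auto
  next
    assume "\<forall>w\<in>h ` unit_disk. Im w < y"
    then show ?thesis
      unfolding image_in_half_plane_def by (intro exI [of _ "-1"] exI [of _ "- y"]) auto
  qed
qed

section \<open>Order and argument of the leading coefficient\<close>

text \<open>A limit point of the angles \<open>Arg (1 - x n)\<close> along an orbit, where
  \<open>n * (1 - x n) powr \<alpha>\<close> tends to the coefficient. The angle itself is recorded
  because, before \<open>\<alpha> \<le> 1\<close> is known, \<open>\<alpha> * \<theta>\<close> may
  exceed the range of the principal argument.\<close>

lemma leading_coefficient_sector:
  obtains \<theta> where "\<bar>\<theta>\<bar> \<le> pi / 2" "leading_coeff = of_real (cmod leading_coeff) * cis (\<alpha> * \<theta>)"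
proof -
  define x where "x n = F (real n) 0" for n
  have xd: "x n \<in> unit_disk" for n
    unfolding x_def by (intro F_in) auto
  have nz: "1 - x n \<noteq> 0" for n
    unfolding x_def by (rule one_minus_trajectory_nonzero) auto
  have lim: "(\<lambda>n. of_nat n * (1 - x n) powr of_real \<alpha>) \<longlonglongrightarrow> leading_coeff"
    using filterlim_compose [OF time_asymptotics filterlim_real_sequentially, of 0] by (simp add: x_def)
  have "Re (1 - x n) > 0" for n
    using xd [of n] complex_Re_le_cmod [of "x n"] by simp
  then have bounded: "\<forall>n. Arg (1 - x n) \<in> {- (pi / 2)..pi / 2}"
    using Arg_Re_pos by (metis abs_le_iff atLeastAtMost_iff less_imp_le minus_le_iff)
  have "seq_compact {- (pi / 2)..pi / 2}"
    by (intro compact_imp_seq_compact compact_Icc)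
  from seq_compactE [OF this bounded]
  obtain \<theta> and r :: "nat \<Rightarrow> nat" where \<theta>: "\<theta> \<in> {- (pi / 2)..pi / 2}" and r: "strict_mono r"
    and lim\<theta>: "((\<lambda>n. Arg (1 - x n)) \<circ> r) \<longlonglongrightarrow> \<theta>"
    by blast
  have "(\<lambda>n. of_nat (r n) * (1 - x (r n)) powr of_real \<alpha>) \<longlonglongrightarrow> leading_coeff"
    using LIMSEQ_subseq_LIMSEQ [OF lim r] by (simp add: o_def)
  moreover from this
  have norm_lim: "(\<lambda>n. cmod (of_nat (r n) * (1 - x (r n)) powr of_real \<alpha>)) \<longlonglongrightarrow> cmod leading_coeff"
    by (rule tendsto_norm)
  have cis_lim: "(\<lambda>n. cis (\<alpha> * Arg (1 - x (r n)))) \<longlonglongrightarrow> cis (\<alpha> * \<theta>)"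
    using lim\<theta> by (intro tendsto_intros) (simp add: o_def)
  have "(\<lambda>n. of_real (cmod (of_nat (r n) * (1 - x (r n)) powr of_real \<alpha>)) * cis (\<alpha> * Arg (1 - x (r n))))
      \<longlonglongrightarrow> of_real (cmod leading_coeff) * cis (\<alpha> * \<theta>)"
    by (rule tendsto_mult [OF tendsto_of_real [OF norm_lim] cis_lim])
  moreover have "of_real (cmod (of_nat (r n) * (1 - x (r n)) powr of_real \<alpha>)) * cis (\<alpha> * Arg (1 - x (r n)))
      = of_nat (r n) * (1 - x (r n)) powr of_real \<alpha>" for n
    unfolding norm_mult cmod_powr_of_real powr_of_real_polar [OF nz] by simp
  ultimately have "leading_coeff = of_real (cmod leading_coeff) * cis (\<alpha> * \<theta>)"
    by (simp add: LIMSEQ_unique)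
  then show thesis
    using \<theta> by (intro that [of \<theta>]) auto
qed

text \<open>On the ray \<open>1 - r * cis \<theta>\<close> the power of \<open>1 - z\<close> has
  constant argument \<open>\<alpha> * \<theta>\<close>. Multiplying the half-plane inequality by
  \<open>r powr \<alpha>\<close> and letting \<open>r\<close> tend to \<open>0\<close> removes
  \<open>m\<close> and leaves the coefficient.\<close>

lemma half_plane_sector:
  assumes h: "Abel_function h" and m: "\<And>z. z \<in> unit_disk \<Longrightarrow> m < \<sigma> * Im (h z)"
    and \<theta>: "\<bar>\<theta>\<bar> < pi / 2"
  shows "0 \<le> \<sigma> * Im (leading_coeff * cis (- \<alpha> * \<theta>))"
proof -
  define z where "z r = 1 - of_real r * cis \<theta>" for r
  have cos: "cos \<theta> > 0" using \<theta> by (intro cos_gt_zero_pi) auto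
  \<comment> \<open>The chord of the unit disk from \<open>1\<close> in the direction
    \<open>- cis \<theta>\<close> has length \<open>2 * cos \<theta>\<close>.\<close>
  have zd: "z r \<in> unit_disk" if "0 < r" "r < 2 * cos \<theta>" for r
  proof -
    have "(cmod (z r))\<^sup>2 = (1 - r * cos \<theta>)\<^sup>2 + (r * sin \<theta>)\<^sup>2"
      unfolding cmod_power2 by (simp add: z_def)
    also have "\<dots> = 1 - 2 * r * cos \<theta> + r\<^sup>2 * ((cos \<theta>)\<^sup>2 + (sin \<theta>)\<^sup>2)"
      by algebra
    also have "(cos \<theta>)\<^sup>2 + (sin \<theta>)\<^sup>2 = 1"
      by simp
    also have "1 - 2 * r * cos \<theta> + r\<^sup>2 * 1 = 1 - r * (2 * cos \<theta> - r)"
      by (simp add: power2_eq_square algebra_simps)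
    also have "\<dots> < 1" using that by simp
    finally show ?thesis by (simp add: abs_square_less_1)
  qed
  have ev: "\<forall>\<^sub>F r in at_right 0. 0 < r \<and> r < 2 * cos \<theta>"
    using cos by (auto simp: eventually_at_right_field intro!: exI [of _ "2 * cos \<theta>"])
  have "((\<lambda>r. z r) \<longlongrightarrow> 1 - of_real 0 * cis \<theta>) (at_right 0)"
    unfolding z_def by (intro tendsto_intros)
  then have zlim: "(z \<longlongrightarrow> 1) (at_right 0)"
    by (simp add: z_def [abs_def])
  have "\<forall>\<^sub>F r in at_right 0. z r \<in> unit_disk \<and> z r \<noteq> 1"
    using ev
  proof eventually_elim
    fix r assume "0 < r \<and> r < 2 * cos \<theta>"
    then have "z r \<in> unit_disk" by (intro zd) auto
    then show "z r \<in> unit_disk \<and> z r \<noteq> 1" by auto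
  qed
  then have "filterlim z (at 1 within unit_disk) (at_right 0)"
    unfolding filterlim_at using zlim by simp
  then have lim: "((\<lambda>r. h (z r) * (1 - z r) powr of_real \<alpha>) \<longlongrightarrow> leading_coeff) (at_right 0)"
    by (rule filterlim_compose [OF Abel_asymptotics [OF h]])
  have pw: "(1 - z r) powr of_real \<alpha> = of_real (r powr \<alpha>) * cis (\<alpha> * \<theta>)" if "0 < r" for r
  proof -
    have "\<theta> \<in> {- pi<..pi}"
      using \<theta> pi_gt_zero by (simp only: greaterThanAtMost_iff) linarith
    then have "Arg (1 - z r) = \<theta>"
      using that by (simp add: z_def Arg_cis)
    moreover have "cmod (1 - z r) = r"
      using that by (simp add: z_def norm_mult)
    moreover from this that have "1 - z r \<noteq> 0" by auto
    ultimately show ?thesis using powr_of_real_polar [of "1 - z r" \<alpha>] by simp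
  qed
  have "((\<lambda>r. \<sigma> * Im (h (z r) * (1 - z r) powr of_real \<alpha> * cis (- \<alpha> * \<theta>))) \<longlongrightarrow> \<sigma> * Im (leading_coeff * cis (- \<alpha> * \<theta>))) (at_right 0)"
    by (intro tendsto_intros lim)
  moreover have "((\<lambda>r. m * r powr \<alpha>) \<longlongrightarrow> m * 0) (at_right 0)"
    by (intro tendsto_intros tendsto_zero_powrI [OF _ tendsto_const])
      (use \<alpha>_pos in \<open>auto simp: eventually_at_right_field intro: exI [of _ 1]\<close>)
  moreover have "\<forall>\<^sub>F r in at_right 0. m * r powr \<alpha> \<le> \<sigma> * Im (h (z r) * (1 - z r) powr of_real \<alpha> * cis (- \<alpha> * \<theta>))"
    using ev
  proof eventually_elim
    fix r :: real assume r: "0 < r \<and> r < 2 * cos \<theta>"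
    have "h (z r) * (1 - z r) powr of_real \<alpha> * cis (- \<alpha> * \<theta>) = of_real (r powr \<alpha>) * h (z r) * (cis (\<alpha> * \<theta>) * cis (- \<alpha> * \<theta>))"
      using r by (simp only: pw mult_ac)
    also have "\<dots> = of_real (r powr \<alpha>) * h (z r)"
      by (simp add: cis_mult)
    finally have eq: "h (z r) * (1 - z r) powr of_real \<alpha> * cis (- \<alpha> * \<theta>) = of_real (r powr \<alpha>) * h (z r)" .
    have "\<sigma> * Im (h (z r) * (1 - z r) powr of_real \<alpha> * cis (- \<alpha> * \<theta>)) = (\<sigma> * Im (h (z r))) * r powr \<alpha>"
      unfolding eq by simp
    moreover have "m * r powr \<alpha> \<le> (\<sigma> * Im (h (z r))) * r powr \<alpha>"
      using m [OF zd] r by (intro mult_right_mono) (auto intro: less_imp_le)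
    ultimately show "m * r powr \<alpha> \<le> \<sigma> * Im (h (z r) * (1 - z r) powr of_real \<alpha> * cis (- \<alpha> * \<theta>))"
      by (simp only:)
  qed
  ultimately have "m * 0 \<le> \<sigma> * Im (leading_coeff * cis (- \<alpha> * \<theta>))"
    by (intro tendsto_le [OF _ _ _]) auto
  then show ?thesis by simp
qed

text \<open>The rays give all directions \<open>\<alpha> * (\<theta>' - \<theta>)\<close> of the
  sector. Once \<open>\<alpha> \<le> 1\<close> and the absolute value of \<open>\<theta>'\<close> is
  \<open>pi / 2\<close>, the angle \<open>\<alpha> * \<theta>'\<close> is principal and hence equals
  the argument of the coefficient.\<close>

lemma order_and_argument:
  assumes h: "Abel_function h" and hp: "image_in_half_plane h"
  shows "\<alpha> \<le> 1" "\<bar>Arg (- a)\<bar> = pi / 2 * \<alpha>"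
proof -
  obtain \<sigma> m where \<sigma>: "\<bar>\<sigma>\<bar> = 1" and m: "\<And>z. z \<in> unit_disk \<Longrightarrow> m < \<sigma> * Im (h z)"
    using hp unfolding image_in_half_plane_def by metis
  obtain \<theta>' where \<theta>': "\<bar>\<theta>'\<bar> \<le> pi / 2" and polar: "leading_coeff = of_real (cmod leading_coeff) * cis (\<alpha> * \<theta>')"
    by (rule leading_coefficient_sector)
  have "\<alpha> \<le> 1 \<and> \<bar>\<theta>'\<bar> = pi / 2"
  proof (rule sin_sector [OF \<alpha>_pos \<theta>' \<sigma>])
    fix \<theta> :: real assume "\<bar>\<theta>\<bar> < pi / 2"
    then have "0 \<le> \<sigma> * Im (leading_coeff * cis (- \<alpha> * \<theta>))"
      using half_plane_sector [OF h, of m \<sigma> \<theta>] m by blast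
    also have "leading_coeff * cis (- \<alpha> * \<theta>) = of_real (cmod leading_coeff) * cis (\<alpha> * (\<theta>' - \<theta>))"
      by (subst polar) (simp add: mult.assoc cis_mult algebra_simps)
    finally have "0 \<le> cmod leading_coeff * (\<sigma> * sin (\<alpha> * (\<theta>' - \<theta>)))"
      by (simp add: mult.left_commute)
    then show "0 \<le> \<sigma> * sin (\<alpha> * (\<theta>' - \<theta>))"
      using leading_coeff_nonzero by (simp add: zero_le_mult_iff)
  qed
  then have \<alpha>: "\<alpha> \<le> 1" and abs: "\<bar>\<theta>'\<bar> = pi / 2" by auto
  show "\<alpha> \<le> 1" by (rule \<alpha>)
  have abs': "\<bar>\<alpha> * \<theta>'\<bar> = pi / 2 * \<alpha>"
    using \<alpha>_pos abs by (simp add: abs_mult)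
  moreover have "pi / 2 * \<alpha> \<le> pi / 2 * 1"
    using \<alpha> by (intro mult_left_mono) auto
  ultimately have "\<bar>\<alpha> * \<theta>'\<bar> < pi"
    using pi_gt_zero by linarith
  then have "\<alpha> * \<theta>' \<in> {- pi<..pi}"
    unfolding abs_less_iff by simp
  then have "Arg leading_coeff = \<alpha> * \<theta>'"
    using leading_coeff_nonzero by (subst polar) (simp add: Arg_cis)
  moreover have "- a = inverse (of_real \<alpha> * leading_coeff)"
    using \<alpha>_pos a_nonzero by (simp add: leading_coeff_def)
  \<comment> \<open>Inversion negates the principal argument except for real numbers, where it
    preserves it; the absolute value merges the two cases.\<close>
  then have "\<bar>Arg (- a)\<bar> = \<bar>Arg (of_real \<alpha> * leading_coeff)\<bar>"
    by (simp only: Arg_inverse) simp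
  ultimately show "\<bar>Arg (- a)\<bar> = pi / 2 * \<alpha>"
    using abs' \<alpha>_pos by simp
qed

lemma tangential_if_bounded:
  assumes z: "z \<in> unit_disk"
    and bdd: "bdd_above ((\<lambda>t. t * (1 - cmod (F t z)) / cmod (1 - F t z)) ` {0..})"
  shows "converges_tangentially_to_1 (\<lambda>t. F t z)"
  unfolding converges_tangentially_to_1_def
proof
  show "((\<lambda>t. F t z) \<longlongrightarrow> 1) at_top" by (rule F_tendsto_1 [OF z])
  obtain M where M: "\<And>t. t \<ge> 0 \<Longrightarrow> t * (1 - cmod (F t z)) / cmod (1 - F t z) \<le> M"
    using bdd unfolding bdd_above_def by auto
  have lim: "((\<lambda>t. M / t) \<longlongrightarrow> 0) at_top"
    by (rule real_tendsto_divide_at_top [OF tendsto_const filterlim_ident])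
  show "((\<lambda>t. (1 - cmod (F t z)) / cmod (1 - F t z)) \<longlongrightarrow> 0) at_top"
  proof (rule tendsto_sandwich [OF _ _ tendsto_const lim])
    show "\<forall>\<^sub>F t in at_top. 0 \<le> (1 - cmod (F t z)) / cmod (1 - F t z)"
      using eventually_ge_at_top [of 0]
      by eventually_elim (use F_in [OF _ z] in \<open>auto simp: less_imp_le\<close>)
    show "\<forall>\<^sub>F t in at_top. (1 - cmod (F t z)) / cmod (1 - F t z) \<le> M / t"
      using eventually_gt_at_top [of 0]
      by eventually_elim (use M in \<open>simp add: pos_le_divide_eq mult.commute\<close>)
  qed
qed

end

theorem theorem21:
  fixes \<alpha> :: real and a :: complex
    and F :: "real \<Rightarrow> complex \<Rightarrow> complex" and f :: "complex \<Rightarrow> complex"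
  assumes "\<alpha> > 0"
    and "parabolic_semigroup F f"
    and "f \<in> generators_at_1_of_order \<alpha>"
    and "((\<lambda>z. f z / (1 - z) powr of_real (1 + \<alpha>)) \<longlongrightarrow> a) (at 1 within unit_disk)"
    and "a \<noteq> 0"
  shows "((\<exists>G. parabolic_group G \<and> outer_conjugate F G) \<longleftrightarrow>
          (\<forall>z\<in>unit_disk.
             bdd_above ((\<lambda>t. t * (1 - cmod (F t z)) / cmod (1 - F t z)) ` {0..})))
       \<and> ((\<exists>G. parabolic_group G \<and> outer_conjugate F G) \<longrightarrow>
          \<alpha> \<in> {0<..1} \<and>
          \<bar>Arg (- a)\<bar> = pi / 2 * \<alpha> \<and>
          (\<forall>z\<in>unit_disk. converges_tangentially_to_1 (\<lambda>t. F t z)))"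
proof -
  interpret disk_semigroup_of_order F f \<alpha> a
    using assms by unfold_locales (auto simp: parabolic_semigroup_def)
  obtain h where h: "Abel_function h" by (rule Abel_function_exists)
  have conj_iff: "(\<exists>G. parabolic_group G \<and> outer_conjugate F G) \<longleftrightarrow> image_in_half_plane h"
    using half_plane_if_outer_conjugate [OF h] outer_conjugate_if_half_plane [OF h] by blast
  have bdd_iff: "image_in_half_plane h \<longleftrightarrow> (\<forall>z\<in>unit_disk.
      bdd_above ((\<lambda>t. t * (1 - cmod (F t z)) / cmod (1 - F t z)) ` {0..}))"
  proof
    assume "image_in_half_plane h"
    then show "\<forall>z\<in>unit_disk. bdd_above ((\<lambda>t. t * (1 - cmod (F t z)) / cmod (1 - F t z)) ` {0..})"
      by (intro ballI bounded_if_half_plane [OF h])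
  next
    assume "\<forall>z\<in>unit_disk. bdd_above ((\<lambda>t. t * (1 - cmod (F t z)) / cmod (1 - F t z)) ` {0..})"
    then show "image_in_half_plane h"
      by (intro half_plane_if_bounded [OF h, of 0]) simp_all
  qed
  show ?thesis
    unfolding conj_iff
    using bdd_iff order_and_argument [OF h] tangential_if_bounded \<alpha>_pos by auto
qed

end
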